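(* Let $\Gamma$ be one of the Coxeter groups $A_3$, $B_3$ or $H_3$, with its standard Coxeter generators $S=\{s_1,s_2,s_3\}$. Then the second highest eigenvalue $\lambda_1(X)$ of $P_X$ has multiplicity equal to three for all $X\in\mathrm{int}(\Delta)$.
   Context: $\Delta=\{(x_1,x_2,x_3)\mid x_j\ge0,\ x_1+x_2+x_3=1\}$ and $\mathrm{int}(\Delta)$ is the subset where all $x_j>0$. For $X=(x_1,x_2,x_3)\in\Delta$, $P_X$ is the operator $P_Xf(\gamma)=\sum_{j=1}^3x_jf(\gamma s_j)$ on real functions $f$ on $\Gamma$ (the vertex set of the Cayley graph $\mathrm{Cay}(\Gamma,S)$). Its eigenvalues, counted with multiplicity, are $1=\lambda_0(X)\ge\lambda_1(X)\ge\cdots\ge\lambda_{|\Gamma|-1}(X)\ge-1$. *)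

theory Defs
  imports
    "HOL-Analysis.Finite_Cartesian_Product"
    "HOL-Library.Numeral_Type"
    "HOL-Library.Function_Algebras"
    "HOL-Library.Multiset"
    "HOL-Algebra.Generated_Groups"
begin

text \<open>
  A Coxeter system is a group \<open>G\<close> with generators \<open>s i\<close> presented by the
  relations \<open>(s i s j) ^ m i j = 1\<close>, where \<open>m\<close> is the Coxeter matrix. We present it by positive
  words, that is, as the quotient of the free monoid by the least congruence identifying every
  relator with the empty word. Since \<open>m i i = 1\<close>, the relator \<open>[i, i]\<close> makes each letter
  its own inverse, so this is the same as the presentation as a quotient of the free group.
  An entry \<open>m i j = 0\<close> imposes no relation.
\<close>

definition is_coxeter_matrix :: "('i \<Rightarrow> 'i \<Rightarrow> nat) \<Rightarrow> bool" where
  "is_coxeter_matrix m \<longleftrightarrow>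
     (\<forall>i. m i i = 1) \<and> (\<forall>i j. m i j = m j i) \<and> (\<forall>i j. i \<noteq> j \<longrightarrow> m i j \<noteq> 1)"

inductive coxeter_eq :: "('i \<Rightarrow> 'i \<Rightarrow> nat) \<Rightarrow> 'i list \<Rightarrow> 'i list \<Rightarrow> bool"
  for m :: "'i \<Rightarrow> 'i \<Rightarrow> nat" where
  relator: "coxeter_eq m (concat (replicate (m i j) [i, j])) []"
| refl: "coxeter_eq m u u"
| sym: "coxeter_eq m u v \<Longrightarrow> coxeter_eq m v u"
| trans: "coxeter_eq m u v \<Longrightarrow> coxeter_eq m v w \<Longrightarrow> coxeter_eq m u w"
| cong: "coxeter_eq m u v \<Longrightarrow> coxeter_eq m (a @ u @ b) (a @ v @ b)"

definition word_val :: "('a, 'b) monoid_scheme \<Rightarrow> ('i \<Rightarrow> 'a) \<Rightarrow> 'i list \<Rightarrow> 'a" where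
  "word_val G s w = foldr (\<lambda>i g. s i \<otimes>\<^bsub>G\<^esub> g) w \<one>\<^bsub>G\<^esub>"

definition coxeter_system ::
  "('a, 'b) monoid_scheme \<Rightarrow> ('i \<Rightarrow> 'a) \<Rightarrow> ('i \<Rightarrow> 'i \<Rightarrow> nat) \<Rightarrow> bool" where
  "coxeter_system G s m \<longleftrightarrow>
     is_coxeter_matrix m \<and> group G \<and> range s \<subseteq> carrier G \<and> generate G (range s) = carrier G \<and>
     (\<forall>u v. word_val G s u = word_val G s v \<longleftrightarrow> coxeter_eq m u v)"

text \<open>
  The generators are indexed by the three-element type \<open>3\<close>, whose elements are
  \<open>1\<close>, \<open>2\<close> and \<open>3 = 0\<close>. The Coxeter diagram is a path with edge labels \<open>p\<close> between
  \<open>1, 2\<close> and \<open>q\<close> between \<open>2, 3\<close>.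
\<close>

definition path_matrix :: "nat \<Rightarrow> nat \<Rightarrow> 3 \<Rightarrow> 3 \<Rightarrow> nat" where
  "path_matrix p q i j =
     (if i = j then 1 else if {i, j} = {1, 2} then p else if {i, j} = {2, 3} then q else 2)"

definition coxeter_A3 :: "3 \<Rightarrow> 3 \<Rightarrow> nat" where "coxeter_A3 = path_matrix 3 3"
definition coxeter_B3 :: "3 \<Rightarrow> 3 \<Rightarrow> nat" where "coxeter_B3 = path_matrix 3 4"
definition coxeter_H3 :: "3 \<Rightarrow> 3 \<Rightarrow> nat" where "coxeter_H3 = path_matrix 3 5"

lemma is_coxeter_matrix_path: "p \<noteq> 1 \<Longrightarrow> q \<noteq> 1 \<Longrightarrow> is_coxeter_matrix (path_matrix p q)"
  by (auto simp: is_coxeter_matrix_def path_matrix_def insert_commute)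

definition Delta :: "(real ^ 3) set" where
  "Delta = {X. (\<forall>j. X $ j \<ge> 0) \<and> (\<Sum>j\<in>UNIV. X $ j) = 1}"

definition int_Delta :: "(real ^ 3) set" where
  "int_Delta = {X \<in> Delta. \<forall>j. X $ j > 0}"

text \<open>
  A real function on the group is represented by its extension by zero outside the carrier, so
  that these functions form a subspace of all functions \<open>'a \<Rightarrow> real\<close>.
\<close>

definition fun_scale :: "real \<Rightarrow> ('a \<Rightarrow> real) \<Rightarrow> 'a \<Rightarrow> real" where
  "fun_scale c f = (\<lambda>x. c * f x)"

interpretation fun_vs: vector_space "fun_scale :: real \<Rightarrow> ('a \<Rightarrow> real) \<Rightarrow> 'a \<Rightarrow> real"
  by unfold_locales (auto simp: fun_scale_def fun_eq_iff algebra_simps)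

definition fun_space :: "('a, 'b) monoid_scheme \<Rightarrow> ('a \<Rightarrow> real) set" where
  "fun_space G = {f. \<forall>x. x \<notin> carrier G \<longrightarrow> f x = 0}"

definition P_op ::
  "('a, 'b) monoid_scheme \<Rightarrow> (3 \<Rightarrow> 'a) \<Rightarrow> real ^ 3 \<Rightarrow> ('a \<Rightarrow> real) \<Rightarrow> 'a \<Rightarrow> real" where
  "P_op G s X f =
     (\<lambda>\<gamma>. if \<gamma> \<in> carrier G then \<Sum>j\<in>UNIV. X $ j * f (\<gamma> \<otimes>\<^bsub>G\<^esub> s j) else 0)"

definition eigenspace ::
  "('a, 'b) monoid_scheme \<Rightarrow> (3 \<Rightarrow> 'a) \<Rightarrow> real ^ 3 \<Rightarrow> real \<Rightarrow> ('a \<Rightarrow> real) set" where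
  "eigenspace G s X \<mu> = {f \<in> fun_space G. P_op G s X f = fun_scale \<mu> f}"

text \<open>
  In a Coxeter system the \<open>s j\<close> are involutions, so the operator is self-adjoint and geometric
  and algebraic multiplicity agree.
\<close>

definition eig_mult ::
  "('a, 'b) monoid_scheme \<Rightarrow> (3 \<Rightarrow> 'a) \<Rightarrow> real ^ 3 \<Rightarrow> real \<Rightarrow> nat" where
  "eig_mult G s X \<mu> = fun_vs.dim (eigenspace G s X \<mu>)"

text \<open>
  The eigenvalues repeated according to multiplicity and in decreasing order. For a finite group
  only finitely many multiplicities are nonzero, so \<open>Abs_multiset\<close> is applied within its
  domain.
\<close>

definition eigenvalues ::
  "('a, 'b) monoid_scheme \<Rightarrow> (3 \<Rightarrow> 'a) \<Rightarrow> real ^ 3 \<Rightarrow> real list" where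
  "eigenvalues G s X = rev (sorted_list_of_multiset (Abs_multiset (eig_mult G s X)))"

definition lambda ::
  "('a, 'b) monoid_scheme \<Rightarrow> (3 \<Rightarrow> 'a) \<Rightarrow> real ^ 3 \<Rightarrow> nat \<Rightarrow> real" where
  "lambda G s X k = eigenvalues G s X ! k"

end

(* Kassabov's argument for subspace arrangements. Let f_j = (f - R_j f) / 2 be the projection of a
   function f to the (-1)-eigenspace of right translation R_j by s_j, and let a be the Gram matrix
   with entries a_ij = - cos (pi / m_ij). In the dihedral group generated by s_i and s_j one has
   <f_i, f_j> >= a_ij |f_i| |f_j|. If P_X f = mu f and k = (1 - mu) / 2, then the x_j f_j add up to
   k f, so with d_j = |f_j|
     k (sum_j x_j d_j^2) = sum_ij x_i x_j <f_i, f_j> >= sum_ij x_i x_j a_ij d_i d_j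
       >= g (sum_j x_j d_j^2),
   where g > 0 is the least eigenvalue of a diag(x), with a positive eigenvector h. Hence mu = 1 or
   mu <= 1 - 2 g. In the case of equality d is proportional to h and every dihedral estimate is
   sharp, which determines R_i f_j as a combination of f_i and f_j; so f is determined by the three
   numbers f_j(1). Conversely the three coordinates of rho(gamma) h, with rho the reflection
   representation, are independent eigenfunctions for 1 - 2 g. *)

theory Submission
  imports Defs "HOL-Analysis.Cartesian_Space" "HOL-Analysis.Convex"
begin

section \<open>Finiteness of orbits by coset enumeration\<close>

text \<open>A Coxeter system is given only by its presentation, but inner products and the ordered
  spectrum need a finite group. So finiteness comes first, for any maps satisfying the relations.
  The obstacle in the dihedral estimate is the space of functions on which both translations act by
  -1: there the two projections agree and no angle separates them. Its contribution to
  \<open><f_i, f_j>\<close> is a squared norm, so a one-sided bound survives, and this suffices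
  because the weights \<open>x_i x_j\<close> are positive. On the complement the rotation has no
  invariant vectors, so the (-1)-eigenspaces meet at an angle of at least pi / m. The off-diagonal
  entries of \<open>a\<close> are nonpositive, which is why the lowest eigenvector \<open>h\<close>
  of \<open>a diag(x)\<close> can be positive. Positivity lets the quadratic form be written as
  squares of differences of \<open>d_j / h_j\<close>. For X in the interior all coefficients are
  positive, so equality forces every dihedral estimate to be sharp at once.\<close>

lemma finite_orbit_extend:
  fixes T :: "'i \<Rightarrow> 'a \<Rightarrow> 'a" and C :: "('a \<Rightarrow> 'a) list"
  assumes "finite H" and "e \<in> H" and H: "\<forall>j\<in>J. \<forall>h\<in>H. T j h \<in> H"
    and "id \<in> set C"
    and step: "\<forall>i\<in>I. \<forall>c\<in>set C.
       (\<exists>c'\<in>set C. \<forall>x. T i (c x) = c' x) \<or> (\<exists>j\<in>J. \<forall>x. T i (c x) = c (T j x))"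
  shows "\<exists>K. finite K \<and> e \<in> K \<and> (\<forall>i\<in>I. \<forall>h\<in>K. T i h \<in> K)"
proof (intro exI conjI ballI)
  \<comment> \<open>The maps in \<open>C\<close> play the role of coset representatives. The two
    alternatives in \<open>step\<close> are those of Deodhar's lemma: a generator times a minimal
    representative is another one, or it is the same one times a generator of the parabolic
    subgroup.\<close>
  let ?K = "\<Union>c\<in>set C. c ` H"
  show "finite ?K" using assms(1) by simp
  have "id e \<in> ?K" using assms(2,4) by blast
  then show "e \<in> ?K" by simp
  fix i h assume i: "i \<in> I" and "h \<in> ?K"
  then obtain c y where c: "c \<in> set C" "y \<in> H" "h = c y" by blast
  from step i c(1) consider c' where "c' \<in> set C" "T i (c y) = c' y"
    | j where "j \<in> J" "T i (c y) = c (T j y)" by meson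
  then show "T i h \<in> ?K"
  proof cases
    case 1
    then show ?thesis using c by auto
  next
    case 2
    then show ?thesis using c H by auto
  qed
qed

lemma finite_orbit_dihedral:
  fixes T :: "3 \<Rightarrow> 'a \<Rightarrow> 'a"
  assumes inv: "\<And>i x. T i (T i x) = x"
    and q: "q \<in> {3, 4, 5}" and bc: "\<And>x. ((T 2 \<circ> T 3) ^^ q) x = x"
  shows "\<exists>H. finite H \<and> e \<in> H \<and> (\<forall>i\<in>{2, 3}. \<forall>h\<in>H. T i h \<in> H)"
proof -
  define B where "B = T 2"
  define C where "C = T 3"
  have BB: "B (B x) = x" and CC: "C (C x) = x" for x
    by (simp_all add: B_def C_def inv)
  have rel: "((B \<circ> C) ^^ q) x = x" for x using bc by (simp add: B_def C_def)
  \<comment> \<open>These are the minimal representatives of the cosets of the subgroup of order two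
    in the dihedral group of order \<open>2 * q\<close>; \<open>take q\<close> keeps those shorter
    than the longest element.\<close>
  define D :: "('a \<Rightarrow> 'a) list" where
    "D = take q [id, B, C \<circ> B, B \<circ> C \<circ> B, C \<circ> B \<circ> C \<circ> B]"
  have fin: "finite {e, C e}" by simp
  have J: "\<forall>j\<in>{3}. \<forall>h\<in>{e, C e}. T j h \<in> {e, C e}"
    using CC by (auto simp: C_def[symmetric])
  have 3: "C (B (C x)) = B (C (B x))" if "q = 3" for x
    using rel[of "C (B (C x))"] that by (simp add: BB CC eval_nat_numeral)
  have 4: "C (B (C (B x))) = B (C (B (C x)))" if "q = 4" for x
    using rel[of "C (B (C (B x)))"] that by (simp add: BB CC eval_nat_numeral)
  have 5: "C (B (C (B (C x)))) = B (C (B (C (B x))))" if "q = 5" for x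
    using rel[of "C (B (C (B (C x))))"] that by (simp add: BB CC eval_nat_numeral)
  have st: "\<forall>i\<in>{2, 3}. \<forall>c\<in>set D.
      (\<exists>c'\<in>set D. \<forall>x. T i (c x) = c' x) \<or> (\<exists>j\<in>{3}. \<forall>x. T i (c x) = c (T j x))"
    using q unfolding insert_iff empty_iff
  proof (elim disjE FalseE)
    assume q: "q = 3"
    show ?thesis
      by (simp add: D_def q BB CC 3 flip: B_def C_def)
  next
    assume q: "q = 4"
    show ?thesis
      by (simp add: D_def q BB CC 4 flip: B_def C_def)
  next
    assume q: "q = 5"
    show ?thesis
      by (simp add: D_def q BB CC 5 flip: B_def C_def)
  qed
  have "id \<in> set D" using q unfolding D_def by (elim insertE) simp_all
  then show ?thesis using finite_orbit_extend[OF fin _ J _ st, of e] by simp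
qed

lemma finite_orbit_rank3:
  fixes T :: "3 \<Rightarrow> 'a \<Rightarrow> 'a"
  assumes inv: "\<And>i x. T i (T i x) = x"
    and ab: "\<And>x. ((T 1 \<circ> T 2) ^^ 3) x = x"
    and ac: "\<And>x. ((T 1 \<circ> T 3) ^^ 2) x = x"
    and q: "q \<in> {3, 4, 5}" and bc: "\<And>x. ((T 2 \<circ> T 3) ^^ q) x = x"
  shows "\<exists>K. finite K \<and> e \<in> K \<and> (\<forall>i. \<forall>h\<in>K. T i h \<in> K)"
proof -
  obtain H where H: "finite H" "e \<in> H" "\<forall>i\<in>{2, 3}. \<forall>h\<in>H. T i h \<in> H"
    using finite_orbit_dihedral[OF inv q bc] by blast
  define A where "A = T 1"
  define B where "B = T 2"
  define C where "C = T 3"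
  have AA: "A (A x) = x" and BB: "B (B x) = x" and CC: "C (C x) = x" for x
    by (simp_all add: A_def B_def C_def inv)
  have ABA: "A (B (A x)) = B (A (B x))" for x
    using ab[of "B (A (B x))"] by (simp add: AA BB eval_nat_numeral flip: A_def B_def)
  have CA: "C (A x) = A (C x)" for x
    using ac[of "C (A x)"] by (simp add: AA CC eval_nat_numeral flip: A_def C_def)
  have rel: "((B \<circ> C) ^^ q) x = x" for x using bc by (simp add: B_def C_def)
  let ?closed = "\<lambda>D. \<forall>i\<in>{1, 2, 3}. \<forall>c\<in>set D.
      (\<exists>c'\<in>set D. \<forall>x. T i (c x) = c' x) \<or> (\<exists>j\<in>{2, 3}. \<forall>x. T i (c x) = c (T j x))"
  \<comment> \<open>The lists have 24 / 6 = 4, 48 / 8 = 6 and 120 / 10 = 12 entries, the indices of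
    the dihedral parabolic subgroup. Each fact \<open>r1\<close>, \<open>r2\<close>, ... is a case
    of the second alternative: a generator passes through a representative and comes out as
    \<open>B\<close> or \<open>C\<close>.\<close>
  have "\<exists>D. id \<in> set D \<and> ?closed D"
    using q unfolding insert_iff empty_iff
  proof (elim disjE FalseE)
    assume q: "q = 3"
    have CBC: "C (B (C x)) = B (C (B x))" for x
      using rel[of "C (B (C x))"] q by (simp add: BB CC eval_nat_numeral)
    show ?thesis
      by (rule exI[of _ "[id, A, B \<circ> A, C \<circ> B \<circ> A]"])
        (simp add: AA BB CC ABA CBC flip: CA A_def B_def C_def)
  next
    assume q: "q = 4"
    have CBCB: "C (B (C (B x))) = B (C (B (C x)))" for x
      using rel[of "C (B (C (B x)))"] q by (simp add: BB CC eval_nat_numeral)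
    have r1: "B (A (B (C (B (A x))))) = A (B (C (B (A (B x)))))" for x
    proof -
      have "B (A (B (C (B (A x))))) = A (B (A (C (B (A x)))))" by (simp only: ABA)
      also have "\<dots> = A (B (C (A (B (A x)))))" by (simp only: CA)
      also have "\<dots> = A (B (C (B (A (B x)))))" by (simp only: ABA)
      finally show ?thesis .
    qed
    have r2: "C (A (B (C (B (A x))))) = A (B (C (B (A (C x)))))" for x
    proof -
      have "C (A (B (C (B (A x))))) = A (C (B (C (B (A x)))))" by (simp only: CA)
      also have "\<dots> = A (B (C (B (C (A x)))))" by (simp only: CBCB)
      also have "\<dots> = A (B (C (B (A (C x)))))" by (simp only: CA)
      finally show ?thesis .
    qed
    show ?thesis
      by (rule exI[of _ "[id, A, B \<circ> A, C \<circ> B \<circ> A, B \<circ> C \<circ> B \<circ> A, A \<circ> B \<circ> C \<circ> B \<circ> A]"])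
        (simp add: AA BB CC ABA CBCB r1 r2 flip: CA A_def B_def C_def)
  next
    assume q: "q = 5"
    have CBCBC: "C (B (C (B (C x)))) = B (C (B (C (B x))))" for x
      using rel[of "C (B (C (B (C x))))"] q by (simp add: BB CC eval_nat_numeral)
    have r1: "B (C (B (C (B (A x))))) = C (B (C (B (A (C x)))))" for x
    proof -
      have "B (C (B (C (B (A x))))) = C (B (C (B (C (A x)))))" by (simp only: CBCBC)
      also have "\<dots> = C (B (C (B (A (C x)))))" by (simp only: CA)
      finally show ?thesis .
    qed
    have r2: "A (B (C (A (B (C (B (A x))))))) = B (C (A (B (C (B (A (C x)))))))" for x
    proof -
      have "A (B (C (A (B (C (B (A x))))))) = A (B (A (C (B (C (B (A x)))))))" by (simp only: CA)
      also have "\<dots> = B (A (B (C (B (C (B (A x)))))))" by (simp only: ABA)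
      also have "\<dots> = B (A (C (B (C (B (C (A x)))))))" by (simp only: CBCBC)
      also have "\<dots> = B (C (A (B (C (B (A (C x)))))))" by (simp only: CA)
      finally show ?thesis .
    qed
    have r3: "A (C (B (C (A (B (C (B (A x)))))))) = C (B (C (A (B (C (B (A (C x))))))))" for x
    proof -
      have "A (C (B (C (A (B (C (B (A x)))))))) = C (A (B (A (C (B (C (B (A x))))))))" by (simp only: CA)
      also have "\<dots> = C (B (A (B (C (B (C (B (A x))))))))" by (simp only: ABA)
      also have "\<dots> = C (B (A (C (B (C (B (C (A x))))))))" by (simp only: CBCBC)
      also have "\<dots> = C (B (C (A (B (C (B (A (C x))))))))" by (simp only: CA)
      finally show ?thesis .
    qed
    have r4: "C (B (C (B (C (A (B (C (B (A x))))))))) = B (C (B (C (A (B (C (B (A (B x)))))))))" for x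
    proof -
      have "C (B (C (B (C (A (B (C (B (A x))))))))) = B (C (B (C (B (A (B (C (B (A x)))))))))" by (simp only: CBCBC)
      also have "\<dots> = B (C (B (C (A (B (A (C (B (A x)))))))))" by (simp only: ABA)
      also have "\<dots> = B (C (B (C (A (B (C (A (B (A x)))))))))" by (simp only: CA)
      also have "\<dots> = B (C (B (C (A (B (C (B (A (B x)))))))))" by (simp only: ABA)
      finally show ?thesis .
    qed
    have r5: "B (A (B (C (B (C (A (B (C (B (A x)))))))))) = A (B (C (B (C (A (B (C (B (A (C x))))))))))" for x
    proof -
      have "B (A (B (C (B (C (A (B (C (B (A x)))))))))) = A (B (A (C (B (C (A (B (C (B (A x))))))))))" by (simp only: ABA)
      also have "\<dots> = A (B (C (A (B (A (C (B (C (B (A x))))))))))" by (simp only: CA)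
      also have "\<dots> = A (B (C (B (A (B (C (B (C (B (A x))))))))))" by (simp only: ABA)
      also have "\<dots> = A (B (C (B (A (C (B (C (B (C (A x))))))))))" by (simp only: CBCBC)
      also have "\<dots> = A (B (C (B (C (A (B (C (B (A (C x))))))))))" by (simp only: CA)
      finally show ?thesis .
    qed
    have r6: "C (A (B (C (B (C (A (B (C (B (A x)))))))))) = A (B (C (B (C (A (B (C (B (A (B x))))))))))" for x
    proof -
      have "C (A (B (C (B (C (A (B (C (B (A x)))))))))) = A (C (B (C (B (C (A (B (C (B (A x))))))))))" by (simp only: CA)
      also have "\<dots> = A (B (C (B (C (B (A (B (C (B (A x))))))))))" by (simp only: CBCBC)
      also have "\<dots> = A (B (C (B (C (A (B (A (C (B (A x))))))))))" by (simp only: ABA)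
      also have "\<dots> = A (B (C (B (C (A (B (C (A (B (A x))))))))))" by (simp only: CA)
      also have "\<dots> = A (B (C (B (C (A (B (C (B (A (B x))))))))))" by (simp only: ABA)
      finally show ?thesis .
    qed
    have r7: "B (A (B (C (B (A x))))) = A (B (C (B (A (B x)))))" for x
    proof -
      have "B (A (B (C (B (A x))))) = A (B (A (C (B (A x)))))" by (simp only: ABA)
      also have "\<dots> = A (B (C (A (B (A x)))))" by (simp only: CA)
      also have "\<dots> = A (B (C (B (A (B x)))))" by (simp only: ABA)
      finally show ?thesis .
    qed
    have r8: "A (C (B (A x))) = C (B (A (B x)))" for x
    proof -
      have "A (C (B (A x))) = C (A (B (A x)))" by (simp only: CA)
      also have "\<dots> = C (B (A (B x)))" by (simp only: ABA)
      finally show ?thesis .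
    qed

    \<comment> \<open>the minimal coset representatives of the parabolic subgroup of order 10\<close>
    show ?thesis
      by (rule exI[of _ "[id, A, B \<circ> A, C \<circ> B \<circ> A, B \<circ> C \<circ> B \<circ> A, A \<circ> B \<circ> C \<circ> B \<circ> A,
          C \<circ> B \<circ> C \<circ> B \<circ> A, C \<circ> A \<circ> B \<circ> C \<circ> B \<circ> A, B \<circ> C \<circ> A \<circ> B \<circ> C \<circ> B \<circ> A,
          C \<circ> B \<circ> C \<circ> A \<circ> B \<circ> C \<circ> B \<circ> A, B \<circ> C \<circ> B \<circ> C \<circ> A \<circ> B \<circ> C \<circ> B \<circ> A,
          A \<circ> B \<circ> C \<circ> B \<circ> C \<circ> A \<circ> B \<circ> C \<circ> B \<circ> A]"])
        (simp add: AA BB CC ABA r1 r2 r3 r4 r5 r6 r7 r8 flip: CA A_def B_def C_def)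
  qed
  then obtain D where "id \<in> set D" "?closed D" by blast
  then obtain K where "finite K" "e \<in> K" "\<forall>i\<in>{1, 2, 3}. \<forall>h\<in>K. T i h \<in> K"
    using finite_orbit_extend[OF H, of D "{1, 2, 3}"] by blast
  then show ?thesis using exhaust_3 by (metis insertCI)
qed

section \<open>Pairs of involutions\<close>

definition ip :: "'a set \<Rightarrow> ('a \<Rightarrow> real) \<Rightarrow> ('a \<Rightarrow> real) \<Rightarrow> real" where
  "ip K f g = (\<Sum>x\<in>K. f x * g x)"

definition nrm :: "'a set \<Rightarrow> ('a \<Rightarrow> real) \<Rightarrow> real" where
  "nrm K f = sqrt (ip K f f)"

lemma ip_commute: "ip K f g = ip K g f"
  by (simp add: ip_def mult.commute)

lemma ip_self_nonneg: "0 \<le> ip K f f"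
  by (auto simp: ip_def intro: sum_nonneg)

lemma nrm_nonneg: "0 \<le> nrm K f" by (simp add: nrm_def ip_self_nonneg)

lemma nrm_sq: "nrm K f * nrm K f = ip K f f"
  by (simp add: nrm_def ip_self_nonneg)

lemma ip_self_eq_0: "finite K \<Longrightarrow> ip K f f = 0 \<longleftrightarrow> (\<forall>x\<in>K. f x = 0)"
  by (simp add: ip_def sum_nonneg_eq_0_iff)

lemma ip_le_nrm: "\<bar>ip K f g\<bar> \<le> nrm K f * nrm K g"
proof -
  have "(ip K f g)\<^sup>2 \<le> ip K f f * ip K g g"
    using Cauchy_Schwarz_ineq_sum[of f g K] by (simp add: ip_def power2_eq_square)
  then show ?thesis
    by (metis real_sqrt_abs real_sqrt_le_mono nrm_def real_sqrt_mult)
qed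

lemma ip_comp:
  assumes "bij_betw A K K"
  shows "ip K (\<lambda>x. f (A x)) (\<lambda>x. g (A x)) = ip K f g"
  unfolding ip_def using sum.reindex_bij_betw[OF assms, of "\<lambda>x. f x * g x"] by simp

lemma ip_linear:
  "ip K (\<lambda>x. f x + g x) h = ip K f h + ip K g h"
  "ip K (\<lambda>x. f x - g x) h = ip K f h - ip K g h"
  "ip K (\<lambda>x. c * f x) h = c * ip K f h"
  "ip K h (\<lambda>x. f x + g x) = ip K h f + ip K h g"
  "ip K h (\<lambda>x. f x - g x) = ip K h f - ip K h g"
  "ip K h (\<lambda>x. c * f x) = c * ip K h f"
  by (simp_all add: ip_def algebra_simps sum.distrib sum_subtractf sum_distrib_left)

lemma ip_cong: "(\<And>x. x \<in> K \<Longrightarrow> f x = f' x) \<Longrightarrow> (\<And>x. x \<in> K \<Longrightarrow> g x = g' x) \<Longrightarrow> ip K f g = ip K f' g'"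
  by (simp add: ip_def)

lemma sum_lessThan_shift_cyclic:
  fixes f :: "nat \<Rightarrow> 'b::comm_monoid_add"
  assumes "f m = f 0"
  shows "(\<Sum>l<m. f (Suc l)) = (\<Sum>l<m. f l)"
proof (cases m)
  case (Suc n)
  show ?thesis unfolding Suc sum.lessThan_Suc[of "\<lambda>l. f (Suc l)"] sum.lessThan_Suc_shift[of f]
    using assms Suc by (simp add: add.commute)
qed simp

text \<open>The values of \<open>cos (pi / m)\<close>; only \<open>m \<in> {2, 3, 4, 5}\<close> is meaningful.\<close>

definition coxeter_cos :: "nat \<Rightarrow> real" where
  "coxeter_cos m = (if m = 2 then 0 else if m = 3 then 1 / 2
     else if m = 4 then sqrt 2 / 2 else (1 + sqrt 5) / 4)"

lemma coxeter_cos_nonneg: "0 \<le> coxeter_cos m"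
  by (simp add: coxeter_cos_def)

text \<open>The relations are required on the whole type and only the invariance refers to
  \<open>K\<close>. The action need not be free: the functions on \<open>K\<close> form some
  representation of a dihedral group, and nothing more is needed.\<close>

locale involution_pair =
  fixes K :: "'a set" and A B :: "'a \<Rightarrow> 'a" and m :: nat
  assumes fin: "finite K"
    and AA: "A (A x) = x" and BB: "B (B x) = x"
    and AK: "x \<in> K \<Longrightarrow> A x \<in> K" and BK: "x \<in> K \<Longrightarrow> B x \<in> K"
    and rel: "((A \<circ> B) ^^ m) x = x"
    and m: "m \<in> {2, 3, 4, 5}"
begin

definition "G = A \<circ> B"
definition "R = B \<circ> A"

lemma G_simp: "G x = A (B x)" and R_simp: "R x = B (A x)"
  by (simp_all add: G_def R_def)

lemma G_pow_m: "(G ^^ m) x = x"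
  using rel by (simp only: G_def)

lemma bij_A: "bij_betw A K K"
  by (rule bij_betwI[where g = A]) (auto simp: AA AK)

lemma bij_B: "bij_betw B K K"
  by (rule bij_betwI[where g = B]) (auto simp: BB BK)

lemma bij_G: "bij_betw G K K"
  unfolding G_def by (rule bij_betw_trans[OF bij_B bij_A])

lemma bij_G_pow: "bij_betw (G ^^ l) K K"
proof (induction l)
  case (Suc l)
  show ?case unfolding funpow.simps by (rule bij_betw_trans[OF Suc bij_G])
qed (simp add: bij_betw_def)

lemma inverse_pow: "l \<le> m \<Longrightarrow> (R ^^ l) x = (G ^^ (m - l)) x"
proof (induction l arbitrary: x)
  case 0 then show ?case by (simp add: G_pow_m)
next
  case (Suc l)
  have "(R ^^ Suc l) x = R ((G ^^ (m - l)) x)" using Suc by simp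
  also have "m - l = Suc (m - Suc l)" using Suc by simp
  finally show ?case by (simp add: AA BB G_simp R_simp)
qed

lemma swap: "involution_pair K B A m"
proof
  fix x
  show "((B \<circ> A) ^^ m) x = x" using inverse_pow[of m x] by (simp add: R_def)
qed (use fin AA BB AK BK m in auto)

text \<open>As \<open>y\<close> is odd under \<open>A\<close>, its projection is
  \<open>w = (y + y \<circ> G) / 2\<close>, so everything is expressed by the autocorrelations of
  \<open>y\<close> along the rotation \<open>G\<close>. The hypothesis \<open>y0\<close> says that
  \<open>y\<close> has no rotation-invariant part, which excludes the eigenvalue 1 of
  \<open>G\<close>.\<close>

lemma gap:
  assumes yA: "\<And>x. x \<in> K \<Longrightarrow> y (A x) = - y x"
    and y0: "\<And>x. x \<in> K \<Longrightarrow> (\<Sum>l<m. y ((G ^^ l) x)) = 0"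
  defines "w \<equiv> \<lambda>x. (y x - y (B x)) / 2"
  shows "nrm K w \<le> coxeter_cos m * nrm K y"
proof -
  define z where "z l = ip K y (\<lambda>x. y ((G ^^ l) x))" for l
  have S: "ip K (\<lambda>x. y ((G ^^ i) x)) (\<lambda>x. y ((G ^^ j) x)) = z (j - i)" if "i \<le> j" for i j
  proof -
    have "(G ^^ j) x = (G ^^ (j - i)) ((G ^^ i) x)" for x
      using that by (simp flip: funpow_add comp_apply[of "G ^^ (j - i)"])
    then show ?thesis
      using ip_comp[OF bij_G_pow[of i], of y "\<lambda>x. y ((G ^^ (j - i)) x)"] by (simp add: z_def)
  qed
  have z_refl: "z (m - l) = z l" if "l \<le> m" for l
  proof -
    have "z (m - l) = ip K (\<lambda>x. y ((G ^^ l) x)) (\<lambda>x. y ((G ^^ m) x))"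
      using S[of l m] that by simp
    also have "\<dots> = z l" by (simp add: G_pow_m ip_commute z_def)
    finally show ?thesis .
  qed
  have z0: "z 0 = ip K y y" by (simp add: z_def)
  have sum0: "(\<Sum>l<m. z l) = 0"
  proof -
    have "(\<Sum>l<m. z l) = (\<Sum>x\<in>K. y x * (\<Sum>l<m. y ((G ^^ l) x)))"
      unfolding z_def ip_def sum_distrib_left by (rule sum.swap)
    then show ?thesis using y0 by simp
  qed
  have w: "w x = 1 / 2 * (y x + y ((G ^^ 1) x))" if "x \<in> K" for x
  proof -
    have "y (B x) = - y ((G ^^ 1) x)"
      using yA[OF BK[OF that]] AA by (simp add: G_simp)
    then show ?thesis unfolding w_def by simp
  qed
  have "ip K w w = ip K (\<lambda>x. 1 / 2 * (y x + y ((G ^^ 1) x))) (\<lambda>x. 1 / 2 * (y x + y ((G ^^ 1) x)))"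
    by (rule ip_cong) (fact w)+
  also have "\<dots> = (z 0 + z 1) / 2"
    using S[of 1 1] S[of 0 1] ip_commute[of K y "\<lambda>x. y ((G ^^ 1) x)"]
    unfolding ip_linear by (simp add: z0 field_simps)
  finally have ww: "ip K w w = (z 0 + z 1) / 2" .
  \<comment> \<open>By the double angle formula this is
    \<open>z 1 \<le> cos (2 pi / m) * z 0\<close>. For \<open>m = 2\<close> and
    \<open>m = 3\<close>, \<open>sum0\<close> and the symmetry of \<open>z\<close> already determine
    \<open>z 1\<close>. For \<open>m = 4\<close> and \<open>m = 5\<close> the nonnegativity of one
    further square is needed.\<close>
  have "(z 0 + z 1) / 2 \<le> (coxeter_cos m)\<^sup>2 * z 0"
    using m unfolding insert_iff empty_iff
  proof (elim disjE FalseE)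
    assume "m = 2"
    then show ?thesis using sum0 by (simp add: eval_nat_numeral coxeter_cos_def)
  next
    assume m: "m = 3"
    then show ?thesis using sum0 z_refl[of 1]
      by (simp add: eval_nat_numeral coxeter_cos_def)
  next
    assume m: "m = 4"
    have "0 \<le> ip K (\<lambda>x. y x + y ((G ^^ 2) x)) (\<lambda>x. y x + y ((G ^^ 2) x))"
      by (rule ip_self_nonneg)
    also have "\<dots> = 2 * z 0 + 2 * z 2"
      using S[of 2 2] S[of 0 2] ip_commute[of K y "\<lambda>x. y ((G ^^ 2) x)"]
      unfolding ip_linear by (simp add: z0)
    finally show ?thesis using sum0 z_refl[of 1] m
      by (simp add: eval_nat_numeral coxeter_cos_def power_divide)
  next
    assume m: "m = 5"
    define t :: real where "t = (sqrt 5 - 1) / 2"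
    have t: "t\<^sup>2 = 1 - t" "0 < t"
      by (simp_all add: t_def power2_eq_square field_simps)
    have c: "coxeter_cos m = (t + 1) / 2"
      using m by (simp add: coxeter_cos_def t_def field_simps)
    \<comment> \<open>\<open>t = 2 cos (2 pi / 5)\<close>, and \<open>- 1 - t = 2 cos (4 pi / 5)\<close> is the other eigenvalue of \<open>G + G\<inverse>\<close>
        besides 2, so that \<open>(G + G\<inverse> - t)\<^sup>2\<close> is a negative multiple of \<open>G + G\<inverse> - t\<close>.\<close>
    let ?u = "\<lambda>x. y ((G ^^ 1) x) + y ((G ^^ 4) x) - t * y x"
    have "0 \<le> ip K ?u ?u"
      by (rule ip_self_nonneg)
    also have "\<dots> = (2 + t\<^sup>2) * z 0 + 2 * z 3 - 2 * t * z 1 - 2 * t * z 4"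
      using S[of 1 1] S[of 4 4] S[of 0 1] S[of 0 4] S[of 1 4] z0
        ip_commute[of K y "\<lambda>x. y ((G ^^ 1) x)"] ip_commute[of K y "\<lambda>x. y ((G ^^ 4) x)"]
        ip_commute[of K "\<lambda>x. y ((G ^^ 4) x)" "\<lambda>x. y ((G ^^ 1) x)"]
      unfolding ip_linear by (simp add: algebra_simps power2_eq_square del: funpow.simps)
    also have "z 4 = z 1" using z_refl[of 1] m by simp
    also have z3: "z 3 = z 2" using z_refl[of 2] m by simp
    finally have 1: "0 \<le> (2 + t\<^sup>2) * z 0 + 2 * z 2 - 4 * t * z 1" by simp
    have 2: "2 * z 2 = - z 0 - 2 * z 1" using sum0 z_refl[of 1] z3 m
      by (simp add: eval_nat_numeral)
    have "(2 + 4 * t) * (t * z 0 / 2 - z 1) = (t + 2 * t\<^sup>2) * z 0 - 2 * z 1 - 4 * t * z 1"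
      by (simp add: algebra_simps power2_eq_square)
    also have "\<dots> = (2 + t\<^sup>2) * z 0 + 2 * z 2 - 4 * t * z 1"
      unfolding t(1) 2 by (simp add: algebra_simps)
    finally have "0 \<le> (2 + 4 * t) * (t * z 0 / 2 - z 1)" using 1 by simp
    then have "0 \<le> t * z 0 / 2 - z 1" using t(2) by (simp add: zero_le_mult_iff)
    moreover have "(coxeter_cos m)\<^sup>2 = (1 + t / 2) / 2"
      using t(1) unfolding c by (simp add: power2_eq_square field_simps)
    ultimately show ?thesis by (simp add: algebra_simps)
  qed
  then have "ip K w w \<le> (coxeter_cos m)\<^sup>2 * ip K y y" using ww z0 by simp
  then have "sqrt (ip K w w) \<le> sqrt ((coxeter_cos m)\<^sup>2 * ip K y y)" by simp
  then show ?thesis by (simp add: nrm_def real_sqrt_mult coxeter_cos_nonneg)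
qed

section \<open>The common (-1)-eigenspace of the two involutions\<close>

definition cyc :: "('a \<Rightarrow> real) \<Rightarrow> 'a \<Rightarrow> real" where
  "cyc v x = (\<Sum>l<m. v ((G ^^ l) x))"

text \<open>
  The orthogonal projection to the functions on which both involutions act by \<open>-1\<close>. On that
  subspace the two projections coincide, so the estimate \<open>gap\<close> can only hold on its complement.
\<close>

definition antisymmetrize :: "('a \<Rightarrow> real) \<Rightarrow> 'a \<Rightarrow> real" where
  "antisymmetrize v x = (cyc v x - cyc v (A x)) / (2 * real m)"

lemma cyc_G: "cyc v (G x) = cyc v x"
  unfolding cyc_def using sum_lessThan_shift_cyclic[of "\<lambda>l. v ((G ^^ l) x)" m]
  by (simp add: G_pow_m funpow_swap1)

lemma cyc_B: "cyc v (B x) = cyc v (A x)"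
  using cyc_G[of v "B x"] by (simp add: G_simp BB)

lemma cyc_reverse: "(\<Sum>l<m. v ((R ^^ l) x)) = cyc v x"
proof -
  have "(\<Sum>l<m. v ((R ^^ l) x)) = (\<Sum>l<m. v ((G ^^ (m - l)) x))"
    by (rule sum.cong) (simp_all add: inverse_pow)
  also have "\<dots> = (\<Sum>l<m. v ((G ^^ Suc l) x))"
    by (subst sum.nat_diff_reindex[symmetric]) (rule sum.cong, simp_all add: Suc_diff_Suc)
  also have "\<dots> = cyc v x"
    unfolding cyc_def using sum_lessThan_shift_cyclic[of "\<lambda>l. v ((G ^^ l) x)" m]
    by (simp add: G_pow_m)
  finally show ?thesis .
qed

lemma A_G_pow: "A ((G ^^ l) x) = (R ^^ l) (A x)"
proof (induction l)
  case (Suc l)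
  have "A (G y) = R (A y)" for y by (simp add: AA G_simp R_simp)
  then show ?case using Suc by simp
qed simp

lemma antisym_A: "antisymmetrize v (A x) = - antisymmetrize v x"
  by (simp add: antisymmetrize_def AA minus_divide_left)

lemma antisym_B: "antisymmetrize v (B x) = - antisymmetrize v x"
  using cyc_G[of v x] by (simp add: antisymmetrize_def cyc_B G_simp AA minus_divide_left)

lemma antisym_G_pow: "antisymmetrize v ((G ^^ l) x) = antisymmetrize v x"
  by (induction l) (simp_all add: G_simp antisym_A antisym_B)

text \<open>The rotation average of the odd part of \<open>v\<close> is exactly
  \<open>antisymmetrize v\<close>. Subtracting it therefore produces a function satisfying the
  hypothesis \<open>y0\<close> of \<open>gap\<close>.\<close>

lemma cyc_sub_antisym:
  "(\<Sum>l<m. (v ((G ^^ l) x) - v (A ((G ^^ l) x))) / 2 - antisymmetrize v ((G ^^ l) x)) = 0"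
proof -
  have "(\<Sum>l<m. v (A ((G ^^ l) x))) = cyc v (A x)"
    by (simp add: A_G_pow cyc_reverse)
  moreover have "real m * antisymmetrize v x = (cyc v x - cyc v (A x)) / 2"
    using m by (auto simp: antisymmetrize_def)
  ultimately show ?thesis
    by (simp add: sum_subtractf antisym_G_pow flip: sum_divide_distrib cyc_def)
qed

lemma ip_antisym: "ip K (antisymmetrize v) (antisymmetrize v) = ip K (antisymmetrize v) v"
proof -
  have G: "ip K (antisymmetrize v) (\<lambda>x. v ((G ^^ l) x)) = ip K (antisymmetrize v) v" for l
    using ip_comp[OF bij_G_pow[of l], of "antisymmetrize v" v] by (simp add: antisym_G_pow)
  have 1: "ip K (antisymmetrize v) (cyc v) = m * ip K (antisymmetrize v) v"
  proof -
    have "ip K (antisymmetrize v) (cyc v) = (\<Sum>l<m. ip K (antisymmetrize v) (\<lambda>x. v ((G ^^ l) x)))"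
      unfolding cyc_def ip_def sum_distrib_left by (rule sum.swap)
    then show ?thesis by (simp add: G)
  qed
  have 2: "ip K (antisymmetrize v) (\<lambda>x. cyc v (A x)) = - ip K (antisymmetrize v) (cyc v)"
    using ip_comp[OF bij_A, of "antisymmetrize v" "cyc v"]
    by (simp add: antisym_A ip_def sum_negf)
  have "antisymmetrize v = (\<lambda>x. 1 / (2 * real m) * (cyc v x - cyc v (A x)))"
    by (simp add: antisymmetrize_def fun_eq_iff)
  then have "ip K (antisymmetrize v) (antisymmetrize v) =
      1 / (2 * real m) * (ip K (antisymmetrize v) (cyc v) - ip K (antisymmetrize v) (\<lambda>x. cyc v (A x)))"
    by (metis ip_linear(5,6))
  then show ?thesis using m 1 2 by auto
qed

lemma R_eq: "involution_pair.G B A = R"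
  by (simp add: involution_pair.G_def[OF swap] R_def)

text \<open>Rotations in either direction give the same sums, so one and the same function can be
  subtracted from both projections.\<close>

lemma antisym_swap: "involution_pair.antisymmetrize B A m v = antisymmetrize v"
  by (simp add: fun_eq_iff antisymmetrize_def cyc_B cyc_reverse R_eq
    involution_pair.antisymmetrize_def[OF swap] involution_pair.cyc_def[OF swap])

lemma gap_proj:
  fixes v
  defines "a \<equiv> \<lambda>x. (v x - v (A x)) / 2"
  defines "a' \<equiv> \<lambda>x. a x - antisymmetrize v x"
  shows "nrm K (\<lambda>x. (a' x - a' (B x)) / 2) \<le> coxeter_cos m * nrm K a'"
    and "ip K a' a' = ip K a a - ip K (antisymmetrize v) (antisymmetrize v)"
    and "ip K (antisymmetrize v) a = ip K (antisymmetrize v) (antisymmetrize v)"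
proof -
  show "nrm K (\<lambda>x. (a' x - a' (B x)) / 2) \<le> coxeter_cos m * nrm K a'"
  proof (rule gap)
    show "a' (A x) = - a' x" for x
      by (simp add: a'_def a_def antisym_A AA field_simps)
    show "(\<Sum>l<m. a' ((G ^^ l) x)) = 0" for x
      unfolding a'_def a_def by (rule cyc_sub_antisym)
  qed
  have vA: "ip K (antisymmetrize v) (\<lambda>x. v (A x)) = - ip K (antisymmetrize v) v"
    using ip_comp[OF bij_A, of "antisymmetrize v" v] by (simp add: antisym_A ip_def sum_negf)
  have "a = (\<lambda>x. 1 / 2 * (v x - v (A x)))"
    by (simp add: a_def fun_eq_iff)
  then show 1: "ip K (antisymmetrize v) a = ip K (antisymmetrize v) (antisymmetrize v)"
    using vA by (simp only: ip_linear ip_antisym) simp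
  then show "ip K a' a' = ip K a a - ip K (antisymmetrize v) (antisymmetrize v)"
    using ip_commute[of K a "antisymmetrize v"] unfolding a'_def ip_linear by simp
qed

text \<open>Splitting off \<open>r\<close> gives \<open><a, b> = |r|^2 + <a', b'>\<close>. As
  \<open>b'\<close> is odd under \<open>B\<close>, \<open>a'\<close> may be replaced by its
  projection \<open>w\<close>, and then Cauchy-Schwarz and \<open>gap\<close> apply. Equality leaves
  no slack in any of these steps, which yields the second claim.\<close>

theorem ip_projections:
  fixes v
  defines "a \<equiv> \<lambda>x. (v x - v (A x)) / 2" and "b \<equiv> \<lambda>x. (v x - v (B x)) / 2"
  shows "ip K a b \<ge> - coxeter_cos m * (nrm K a * nrm K b)"
    and "ip K a b = - coxeter_cos m * (nrm K a * nrm K b) \<Longrightarrow> x \<in> K \<Longrightarrow>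
      nrm K b * ((a x - a (B x)) / 2) = - coxeter_cos m * nrm K a * b x"
proof -
  let ?c = "coxeter_cos m"
  define r where "r = antisymmetrize v"
  define a' where "a' = (\<lambda>x. a x - r x)"
  define b' where "b' = (\<lambda>x. b x - r x)"
  define w where "w = (\<lambda>x. (a' x - a' (B x)) / 2)"
  have w: "nrm K w \<le> ?c * nrm K a'"
    using gap_proj(1)[of v] by (simp add: w_def a'_def a_def r_def)
  have a': "ip K a' a' = ip K a a - ip K r r" and ra: "ip K r a = ip K r r"
    using gap_proj(2,3)[of v] by (simp_all add: a'_def a_def r_def)
  have b': "ip K b' b' = ip K b b - ip K r r" and rb: "ip K r b = ip K r r"
    using involution_pair.gap_proj(2,3)[OF swap, of v]
    by (simp_all add: b'_def b_def r_def antisym_swap)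
  have "nrm K a' \<le> nrm K a" "nrm K b' \<le> nrm K b"
    using a' b' ip_self_nonneg[of K r] by (simp_all add: nrm_def)
  then have n: "?c * nrm K a' * nrm K b' \<le> ?c * nrm K a * nrm K b"
    by (intro mult_mono mult_nonneg_nonneg mult_left_mono coxeter_cos_nonneg nrm_nonneg)
  have ab': "ip K a' b' = ip K a b - ip K r r"
    unfolding a'_def b'_def ip_linear using ra rb ip_commute[of K a r] by simp
  have "b' (B x) = - b' x" for x
    by (simp add: b'_def b_def r_def antisym_B BB field_simps)
  then have aB: "ip K (\<lambda>x. a' (B x)) b' = - ip K a' b'"
    using ip_comp[OF bij_B, of a' b'] by (simp add: ip_def sum_negf)
  have "w = (\<lambda>x. 1 / 2 * (a' x - a' (B x)))" by (simp add: w_def fun_eq_iff)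
  then have wb: "ip K w b' = ip K a' b'" using aB by (simp only: ip_linear) simp
  have "\<bar>ip K w b'\<bar> \<le> nrm K w * nrm K b'" by (rule ip_le_nrm)
  also have "\<dots> \<le> ?c * nrm K a' * nrm K b'" by (intro mult_right_mono w nrm_nonneg)
  also note n
  finally have *: "ip K a b \<ge> ip K r r - ?c * (nrm K a * nrm K b)"
    using wb ab' by (simp add: mult.assoc)
  then show "ip K a b \<ge> - ?c * (nrm K a * nrm K b)"
    using ip_self_nonneg[of K r] by simp
  assume eq: "ip K a b = - ?c * (nrm K a * nrm K b)" and x: "x \<in> K"
  have "ip K r r = 0" using * eq ip_self_nonneg[of K r] by simp
  then have r0: "r x = 0" if "x \<in> K" for x using that ip_self_eq_0[OF fin] by blast
  have a'a: "a' x = a x" and b'b: "b' x = b x" if "x \<in> K" for x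
    using r0[OF that] by (simp_all add: a'_def b'_def)
  have na: "nrm K a' = nrm K a" and nb: "nrm K b' = nrm K b"
    using a' b' \<open>ip K r r = 0\<close> by (simp_all add: nrm_def)
  \<comment> \<open>In the case of equality \<open>w\<close> and \<open>b'\<close> point in opposite
    directions. Scaling by the norms states this without dividing by \<open>nrm K a\<close> or
    \<open>nrm K b\<close>, which may vanish.\<close>
  let ?u = "\<lambda>x. nrm K b * w x + (?c * nrm K a) * b' x"
  have "ip K ?u ?u = (nrm K b)\<^sup>2 * ip K w w + 2 * (nrm K b * (?c * nrm K a) * ip K w b')
      + (?c * nrm K a)\<^sup>2 * ip K b' b'"
    unfolding ip_linear using ip_commute[of K b' w] by (simp add: power2_eq_square algebra_simps)
  also have "ip K w b' = - ?c * (nrm K a * nrm K b)"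
    using wb ab' eq \<open>ip K r r = 0\<close> by simp
  also have "ip K b' b' = (nrm K b)\<^sup>2" using nb nrm_sq[of K b'] by (simp add: power2_eq_square)
  also have "ip K w w = (nrm K w)\<^sup>2" by (simp add: nrm_sq power2_eq_square)
  finally have u: "ip K ?u ?u = (nrm K b)\<^sup>2 * ((nrm K w)\<^sup>2 - (?c * nrm K a)\<^sup>2)"
    by (simp add: power2_eq_square algebra_simps)
  have "(nrm K w)\<^sup>2 \<le> (?c * nrm K a)\<^sup>2"
    using w na by (intro power_mono nrm_nonneg) simp
  then have "ip K ?u ?u \<le> 0" unfolding u by (intro mult_nonneg_nonpos) simp_all
  then have "ip K ?u ?u = 0" using ip_self_nonneg[of K ?u] by (rule antisym)
  then have "\<forall>x\<in>K. ?u x = 0" by (simp only: ip_self_eq_0[OF fin])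
  then have "?u x = 0" using x by (rule bspec)
  then show "nrm K b * ((a x - a (B x)) / 2) = - ?c * nrm K a * b x"
    using x BK by (simp add: w_def a'a b'b)
qed

end

section \<open>Spectral preliminaries\<close>

text \<open>The multiset in \<open>eigenvalues\<close> has the intended counts only for finite
  support, hence \<open>fin\<close>. As 1 is a simple eigenvalue, the increasing list ends with
  \<open>\<mu>\<^sub>0, 1\<close>, so that position 1 of its reversal is
  \<open>\<mu>\<^sub>0\<close>.\<close>

lemma lambda_1_eqI:
  assumes fin: "finite {\<mu>. eig_mult G s X \<mu> > 0}" and one: "eig_mult G s X 1 = 1"
    and pos: "eig_mult G s X \<mu>\<^sub>0 > 0" and lt: "\<mu>\<^sub>0 < 1"
    and le: "\<And>\<mu>. eig_mult G s X \<mu> > 0 \<Longrightarrow> \<mu> = 1 \<or> \<mu> \<le> \<mu>\<^sub>0"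
  shows "lambda G s X 1 = \<mu>\<^sub>0"
proof -
  define M where "M = Abs_multiset (eig_mult G s X)"
  have count: "count M \<mu> = eig_mult G s X \<mu>" for \<mu>
    unfolding M_def using fin by (simp add: Abs_multiset_inverse)
  define N where "N = M - {#1, \<mu>\<^sub>0#}"
  have M: "M = N + {#\<mu>\<^sub>0, 1#}"
  proof (rule multiset_eqI)
    show "count M \<mu> = count (N + {#\<mu>\<^sub>0, 1#}) \<mu>" for \<mu>
      using lt one pos by (auto simp: N_def count)
  qed
  have N: "\<mu> \<le> \<mu>\<^sub>0" if "\<mu> \<in># N" for \<mu>
  proof -
    have "\<mu> \<in># M" using that M by simp
    then have "\<mu> = 1 \<or> \<mu> \<le> \<mu>\<^sub>0" using le count[of \<mu>] by (metis count_greater_zero_iff)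
    moreover have "\<mu> \<noteq> 1" using lt that count[of 1] one by (auto simp: M simp: count_eq_zero_iff)
    ultimately show ?thesis by blast
  qed
  define xs where "xs = sorted_list_of_multiset N @ [\<mu>\<^sub>0, 1]"
  have "sorted xs" using N lt by (fastforce simp: xs_def sorted_append)
  moreover have "mset xs = M" by (simp add: xs_def M)
  ultimately have "sorted_list_of_multiset M = xs"
    by (metis sort_key_id_if_sorted sorted_list_of_multiset_mset sorted_sort_id)
  then show ?thesis
    by (simp add: lambda_def eigenvalues_def xs_def flip: M_def)
qed

text \<open>
  \<open>g\<close> is a root of the characteristic polynomial of the Gram matrix times \<open>diag(x1, x2, x3)\<close>. A root
  below both \<open>x1\<close> and \<open>x3\<close> is what makes the eigenvector positive.
\<close>

lemma perron_pair_aux: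
  fixes x1 x2 x3 p q :: real
  assumes x: "0 < x1" "0 < x2" "0 < x3" and p: "0 < p" and q: "0 < q" "p\<^sup>2 + q\<^sup>2 < 1" and le: "x1 \<le> x3"
  shows "\<exists>g. 0 < g \<and> g < x1 \<and>
    (x1 - g) * (x2 - g) * (x3 - g) = q\<^sup>2 * x2 * x3 * (x1 - g) + p\<^sup>2 * x1 * x2 * (x3 - g)"
proof (cases "x1 = x3")
  case False
  let ?f = "\<lambda>g. (x1 - g) * (x2 - g) * (x3 - g) - q\<^sup>2 * x2 * x3 * (x1 - g) - p\<^sup>2 * x1 * x2 * (x3 - g)"
  \<comment> \<open>The factor \<open>1 - (p\<^sup>2 + q\<^sup>2)\<close> is the determinant of the
    Gram matrix.\<close>
  have "?f 0 = x1 * x2 * x3 * (1 - (p\<^sup>2 + q\<^sup>2))" by (simp add: algebra_simps)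
  then have 0: "?f 0 > 0" using x q by simp
  have 1: "?f x1 < 0" using x p le False by simp
  have "\<exists>g\<ge>0. g \<le> x1 \<and> ?f g = 0"
    by (rule IVT2') (use 0 1 x in \<open>auto intro!: continuous_intros\<close>)
  then obtain g where g: "0 \<le> g" "g \<le> x1" "?f g = 0" by blast
  with 0 1 have "g \<noteq> 0" "g \<noteq> x1" by (metis less_irrefl)+
  with g show ?thesis by (intro exI[of _ g]) simp
next
  case True
  \<comment> \<open>For \<open>x1 = x3\<close> the cubic itself vanishes at \<open>x1\<close>, so it
    has no sign change to offer there. Dividing out the factor \<open>x1 - g\<close> exposes the
    smaller root.\<close>
  let ?f = "\<lambda>g. (x2 - g) * (x1 - g) - (p\<^sup>2 + q\<^sup>2) * x1 * x2"
  have "?f 0 = x1 * x2 * (1 - (p\<^sup>2 + q\<^sup>2))" by (simp add: algebra_simps)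
  then have 0: "?f 0 > 0" using x q by simp
  have 1: "?f x1 < 0" using x p q(1) by (simp add: add_pos_pos)
  have "\<exists>g\<ge>0. g \<le> x1 \<and> ?f g = 0"
    by (rule IVT2') (use 0 1 x in \<open>auto intro!: continuous_intros\<close>)
  then obtain g where g: "0 \<le> g" "g \<le> x1" "?f g = 0" by blast
  with 0 1 have "g \<noteq> 0" "g \<noteq> x1" by (metis less_irrefl)+
  moreover have "(x1 - g) * (x2 - g) * (x3 - g) - q\<^sup>2 * x2 * x3 * (x1 - g) - p\<^sup>2 * x1 * x2 * (x3 - g)
      = (x1 - g) * ?f g" unfolding True by (simp add: algebra_simps)
  ultimately show ?thesis using g by (intro exI[of _ g]) simp
qed

lemma perron_pair:
  fixes x1 x2 x3 p q :: real
  assumes x: "0 < x1" "0 < x2" "0 < x3" and p: "0 < p" and q: "0 < q" "p\<^sup>2 + q\<^sup>2 < 1"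
  obtains g h1 h2 h3 where "0 < g" "0 < h1" "0 < h2" "0 < h3"
    "x1 * h1 - p * x2 * h2 = g * h1"
    "x2 * h2 - p * x1 * h1 - q * x3 * h3 = g * h2"
    "x3 * h3 - q * x2 * h2 = g * h3"
proof -
  obtain g where g: "0 < g" "g < x1" "g < x3" and
    eq: "(x1 - g) * (x2 - g) * (x3 - g) = q\<^sup>2 * x2 * x3 * (x1 - g) + p\<^sup>2 * x1 * x2 * (x3 - g)"
  proof (cases "x1 \<le> x3")
    case True
    then show ?thesis using perron_pair_aux[OF x p q] that by fastforce
  next
    case False
    have q': "q\<^sup>2 + p\<^sup>2 < 1" using q(2) by simp
    obtain g where g: "0 < g" "g < x3" and eq: "(x3 - g) * (x2 - g) * (x1 - g) =
        p\<^sup>2 * x2 * x1 * (x3 - g) + q\<^sup>2 * x3 * x2 * (x1 - g)"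
      using perron_pair_aux[OF x(3,2,1) q(1) p q'] False by auto
    show ?thesis using that[of g] g False eq by (simp add: algebra_simps)
  qed
  show ?thesis
  \<comment> \<open>The outer two equations give \<open>h1\<close> and \<open>h3\<close> in terms of
    \<open>h2\<close>; clearing denominators yields these entries, positive because \<open>g\<close>
    lies below \<open>x1\<close> and \<open>x3\<close>. The middle equation is then the
    characteristic equation.\<close>
  proof (rule that[of g "p * x2 * (x3 - g)" "(x1 - g) * (x3 - g)" "q * x2 * (x1 - g)"])
    show "x2 * ((x1 - g) * (x3 - g)) - p * x1 * (p * x2 * (x3 - g)) - q * x3 * (q * x2 * (x1 - g)) =
      g * ((x1 - g) * (x3 - g))"
      using eq by (simp add: power2_eq_square algebra_simps)
    show "0 < p * x2 * (x3 - g)" "0 < (x1 - g) * (x3 - g)" "0 < q * x2 * (x1 - g)"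
      using g x p q by simp_all
  qed (use g in \<open>simp_all add: algebra_simps\<close>)
qed

text \<open>
  The substitution \<open>d = e h\<close> turns the quadratic form into a sum of squares of differences, which
  vanishes only if \<open>d\<close> is proportional to \<open>h\<close>.
\<close>

lemma ground_state_identity:
  fixes x1 x2 x3 p q g h1 h2 h3 e1 e2 e3 :: real
  assumes "x1 * h1 - p * x2 * h2 = g * h1"
    "x2 * h2 - p * x1 * h1 - q * x3 * h3 = g * h2"
    "x3 * h3 - q * x2 * h2 = g * h3"
  defines "d1 \<equiv> e1 * h1" and "d2 \<equiv> e2 * h2" and "d3 \<equiv> e3 * h3"
  shows "x1\<^sup>2 * d1\<^sup>2 + x2\<^sup>2 * d2\<^sup>2 + x3\<^sup>2 * d3\<^sup>2 - 2 * p * x1 * x2 * (d1 * d2) - 2 * q * x2 * x3 * (d2 * d3)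
      - g * (x1 * d1\<^sup>2 + x2 * d2\<^sup>2 + x3 * d3\<^sup>2)
    = p * x1 * x2 * h1 * h2 * (e1 - e2)\<^sup>2 + q * x2 * x3 * h2 * h3 * (e2 - e3)\<^sup>2" (is "?L = ?R")
proof -
  have "?L - ?R = x1 * h1 * e1\<^sup>2 * (x1 * h1 - p * x2 * h2 - g * h1)
      + x2 * h2 * e2\<^sup>2 * (x2 * h2 - p * x1 * h1 - q * x3 * h3 - g * h2)
      + x3 * h3 * e3\<^sup>2 * (x3 * h3 - q * x2 * h2 - g * h3)"
    unfolding d1_def d2_def d3_def by (simp add: power2_eq_square algebra_simps)
  then show ?thesis using assms(1-3) by simp
qed

section \<open>The spectral gap\<close>

definition gram :: "(3 \<Rightarrow> 3 \<Rightarrow> nat) \<Rightarrow> 3 \<Rightarrow> 3 \<Rightarrow> real" where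
  "gram m i j = (if i = j then 1 else - coxeter_cos (m i j))"

text \<open>The coordinates of a vector are its products with the unit simple roots, whose Gram
  matrix is \<open>gram m\<close>. In them the reflection in the root \<open>i\<close> has this
  form, and a positive \<open>h\<close> is a point of the open fundamental chamber.\<close>

definition reflect :: "(3 \<Rightarrow> 3 \<Rightarrow> nat) \<Rightarrow> 3 \<Rightarrow> real ^ 3 \<Rightarrow> real ^ 3" where
  "reflect m i h = (\<chi> j. h $ j - 2 * gram m i j * h $ i)"

lemma path_matrix_simps:
  "path_matrix p q 1 2 = p" "path_matrix p q 2 1 = p"
  "path_matrix p q 2 3 = q" "path_matrix p q 3 2 = q"
  "path_matrix p q 1 3 = 2" "path_matrix p q 3 1 = 2" "path_matrix p q i i = 1"
  by (auto simp: path_matrix_def doubleton_eq_iff)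

lemma gram_path:
  "gram (path_matrix 3 q) 1 2 = - (1 / 2)" "gram (path_matrix 3 q) 2 1 = - (1 / 2)"
  "gram (path_matrix 3 q) 2 3 = - coxeter_cos q" "gram (path_matrix 3 q) 3 2 = - coxeter_cos q"
  "gram (path_matrix 3 q) 1 3 = 0" "gram (path_matrix 3 q) 3 1 = 0" "gram (path_matrix 3 q) i i = 1"
  by (simp_all add: gram_def path_matrix_simps coxeter_cos_def del: One_nat_def)

text \<open>The second bound makes the Gram determinant positive, which expresses finite type; a
  squared cosine of 3/4, as for the label 6, would give the affine case.\<close>

lemma coxeter_cos_bounds:
  assumes "q \<in> {3, 4, 5}"
  shows "0 < coxeter_cos q" and "(1 / 2)\<^sup>2 + (coxeter_cos q)\<^sup>2 < 1"
proof -
  have s: "0 < sqrt 5" "sqrt 5 < (3::real)" by (simp_all add: real_less_lsqrt)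
  show "0 < coxeter_cos q" using assms s(1) add_pos_pos[OF zero_less_one s(1)] by (auto simp: coxeter_cos_def)
  have "((1 + sqrt 5) / 4)\<^sup>2 = (6 + 2 * sqrt 5) / (16 :: real)"
    by (simp add: power2_eq_square algebra_simps)
  then show "(1 / 2)\<^sup>2 + (coxeter_cos q)\<^sup>2 < 1"
    using assms s(2) by (auto simp: coxeter_cos_def power_divide field_simps)
qed

text \<open>This collects what the spectral argument needs of the group: right translations by
  generators, connectedness of the Cayley graph in the form of \<open>induct\<close>, and a linear
  representation sending the generators to reflections.\<close>

locale coxeter_action =
  fixes K :: "'a set" and e :: 'a and A :: "3 \<Rightarrow> 'a \<Rightarrow> 'a" and q :: nat
    and \<rho> :: "'a \<Rightarrow> real ^ 3 \<Rightarrow> real ^ 3" and X :: "real ^ 3"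
  assumes fin: "finite K" and e: "e \<in> K"
    and AA: "A i (A i x) = x" and AK: "x \<in> K \<Longrightarrow> A i x \<in> K"
    and rel: "((A i \<circ> A j) ^^ path_matrix 3 q i j) x = x"
    and induct: "P e \<Longrightarrow> (\<And>x i. x \<in> K \<Longrightarrow> P x \<Longrightarrow> P (A i x)) \<Longrightarrow> x \<in> K \<Longrightarrow> P x"
    and q: "q \<in> {3, 4, 5}"
    and lin: "x \<in> K \<Longrightarrow> linear (\<rho> x)" and \<rho>_e: "\<rho> e = id"
    and \<rho>_A: "x \<in> K \<Longrightarrow> \<rho> (A i x) h = \<rho> x (reflect (path_matrix 3 q) i h)"
    and X_pos: "0 < X $ j" and X_sum: "(\<Sum>j\<in>UNIV. X $ j) = 1"
begin

abbreviation "c \<equiv> coxeter_cos q"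
abbreviation "a \<equiv> gram (path_matrix 3 q)"

lemma pair: "i \<noteq> j \<Longrightarrow> involution_pair K (A i) (A j) (path_matrix 3 q i j)"
proof unfold_locales
  assume "i \<noteq> j"
  then show "path_matrix 3 q i j \<in> {2, 3, 4, 5}" using q by (auto simp: path_matrix_def)
qed (use fin AA AK rel in auto)

definition eigenfun :: "real \<Rightarrow> ('a \<Rightarrow> real) \<Rightarrow> bool" where
  "eigenfun \<mu> f \<longleftrightarrow> (\<forall>x\<in>K. (\<Sum>j\<in>UNIV. X $ j * f (A j x)) = \<mu> * f x)"

definition skew :: "('a \<Rightarrow> real) \<Rightarrow> 3 \<Rightarrow> 'a \<Rightarrow> real" where
  "skew f j x = (f x - f (A j x)) / 2"

lemma skew_A: "skew f j (A j x) = - skew f j x"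
  by (simp add: skew_def AA field_simps)

lemma bij_A: "bij_betw (A j) K K"
  by (rule bij_betwI[where g = "A j"]) (auto simp: AA AK)

lemma ip_skew: "ip K f (skew f j) = ip K (skew f j) (skew f j)"
proof -
  have "ip K (\<lambda>x. f (A j x)) (skew f j) = - ip K f (skew f j)"
    using ip_comp[OF bij_A[of j], of f "skew f j"] by (simp add: skew_A ip_def sum_negf)
  moreover have "skew f j = (\<lambda>x. 1 / 2 * (f x - f (A j x)))"
    by (simp add: skew_def fun_eq_iff)
  then have "ip K (skew f j) (skew f j) = 1 / 2 * (ip K f (skew f j) - ip K (\<lambda>x. f (A j x)) (skew f j))"
    by (metis ip_linear(2,3))
  ultimately show ?thesis by simp
qed

lemma X_sum3: "X $ 1 + X $ 2 + X $ 3 = 1"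
  using X_sum by (simp add: sum_3)

lemma eigenfun_skew:
  assumes "eigenfun \<mu> f" and "x \<in> K"
  shows "X $ 1 * skew f 1 x + X $ 2 * skew f 2 x + X $ 3 * skew f 3 x = (1 - \<mu>) / 2 * f x"
proof -
  have "X $ 1 * f (A 1 x) + X $ 2 * f (A 2 x) + X $ 3 * f (A 3 x) = \<mu> * f x"
    using assms by (simp add: eigenfun_def sum_3)
  moreover have "f x = X $ 1 * f x + X $ 2 * f x + X $ 3 * f x"
    using X_sum3 by (simp flip: distrib_right)
  ultimately show ?thesis by (simp add: skew_def field_simps)
qed

text \<open>For \<open>f\<close> on \<open>K\<close> this is half the Dirichlet form
  \<open><f, (1 - P_X) f>\<close>.\<close>

definition energy :: "('a \<Rightarrow> real) \<Rightarrow> real" where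
  "energy f = X $ 1 * (nrm K (skew f 1))\<^sup>2 + X $ 2 * (nrm K (skew f 2))\<^sup>2 + X $ 3 * (nrm K (skew f 3))\<^sup>2"

lemma energy_nonneg: "0 \<le> energy f"
  using X_pos by (simp add: energy_def less_imp_le)

lemma energy_eq_0: "energy f = 0 \<Longrightarrow> x \<in> K \<Longrightarrow> skew f j x = 0"
proof -
  assume 0: "energy f = 0" and x: "x \<in> K"
  have n: "0 \<le> X $ j * (nrm K (skew f j))\<^sup>2" for j using X_pos by (simp add: less_imp_le)
  have "X $ 1 * (nrm K (skew f 1))\<^sup>2 = 0 \<and> X $ 2 * (nrm K (skew f 2))\<^sup>2 = 0 \<and> X $ 3 * (nrm K (skew f 3))\<^sup>2 = 0"
    using 0 n[of 1] n[of 2] n[of 3] unfolding energy_def by linarith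
  then have "nrm K (skew f j) = 0"
    using exhaust_3[of j] X_pos[of j] by auto
  then have "ip K (skew f j) (skew f j) = 0" by (metis nrm_sq mult_zero_left)
  then show "skew f j x = 0" using ip_self_eq_0[OF fin] x by blast
qed

lemma energy_eq: "eigenfun \<mu> f \<Longrightarrow> (1 - \<mu>) / 2 * ip K f f = energy f"
proof -
  assume ev: "eigenfun \<mu> f"
  have "(1 - \<mu>) / 2 * ip K f f = ip K f (\<lambda>x. (1 - \<mu>) / 2 * f x)" by (simp only: ip_linear)
  also have "\<dots> = ip K f (\<lambda>x. X $ 1 * skew f 1 x + X $ 2 * skew f 2 x + X $ 3 * skew f 3 x)"
    using eigenfun_skew[OF ev] by (intro ip_cong) simp_all
  also have "\<dots> = energy f"
    unfolding ip_linear by (simp add: energy_def ip_skew power2_eq_square nrm_sq)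
  finally show ?thesis .
qed

lemma energy_eq_ip: 
  assumes ev: "eigenfun \<mu> f"
  shows "(1 - \<mu>) / 2 * energy f =
    (X $ 1)\<^sup>2 * (nrm K (skew f 1))\<^sup>2 + (X $ 2)\<^sup>2 * (nrm K (skew f 2))\<^sup>2 + (X $ 3)\<^sup>2 * (nrm K (skew f 3))\<^sup>2
    + 2 * X $ 1 * X $ 2 * ip K (skew f 1) (skew f 2) + 2 * X $ 2 * X $ 3 * ip K (skew f 2) (skew f 3)
    + 2 * X $ 1 * X $ 3 * ip K (skew f 1) (skew f 3)" (is "_ = ?R")
proof -
  let ?u = "\<lambda>x. X $ 1 * skew f 1 x + X $ 2 * skew f 2 x + X $ 3 * skew f 3 x"
  have "(1 - \<mu>) / 2 * energy f = ip K (\<lambda>x. (1 - \<mu>) / 2 * f x) ?u"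
    unfolding ip_linear by (simp add: energy_def ip_skew power2_eq_square nrm_sq)
  also have "\<dots> = ip K ?u ?u"
    using eigenfun_skew[OF ev] by (intro ip_cong) simp_all
  also have "\<dots> = ?R"
    using ip_commute[of K "skew f 2" "skew f 1"] ip_commute[of K "skew f 3" "skew f 2"]
      ip_commute[of K "skew f 3" "skew f 1"]
    unfolding ip_linear power2_eq_square nrm_sq by (simp add: algebra_simps)
  finally show ?thesis .
qed

text \<open>Translation by an involution is self-adjoint. Orthogonality serves to show that there
  are only finitely many eigenvalues.\<close>

lemma eigenfun_orthogonal:
  assumes f: "eigenfun \<mu> f" and g: "eigenfun \<nu> g" and "\<mu> \<noteq> \<nu>"
  shows "ip K f g = 0"
proof -
  have A: "ip K (\<lambda>x. f (A j x)) g = ip K f (\<lambda>x. g (A j x))" for j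
    using ip_comp[OF bij_A[of j], of f "\<lambda>x. g (A j x)"] by (simp add: AA)
  have "\<mu> * ip K f g = ip K (\<lambda>x. X $ 1 * f (A 1 x) + X $ 2 * f (A 2 x) + X $ 3 * f (A 3 x)) g"
    unfolding ip_linear(3)[symmetric] using f by (intro ip_cong) (simp_all add: eigenfun_def sum_3)
  also have "\<dots> = ip K f (\<lambda>x. X $ 1 * g (A 1 x) + X $ 2 * g (A 2 x) + X $ 3 * g (A 3 x))"
    unfolding ip_linear by (simp add: A)
  also have "\<dots> = \<nu> * ip K f g"
    unfolding ip_linear(6)[symmetric] using g by (intro ip_cong) (simp_all add: eigenfun_def sum_3)
  finally show ?thesis using \<open>\<mu> \<noteq> \<nu>\<close> by simp
qed

text \<open>At the eigenvalue 1 the energy vanishes, so \<open>f\<close> is unchanged along every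
  edge of a connected graph. This makes the top eigenvalue simple.\<close>

lemma eigenfun_1_const:
  assumes ev: "eigenfun 1 f" and "x \<in> K"
  shows "f x = f e"
  using _ _ assms(2)
proof (rule induct[of "\<lambda>x. f x = f e"])
  fix x i assume x: "x \<in> K" and "f x = f e"
  have "energy f = 0" using energy_eq[OF ev] by simp
  then have "skew f i x = 0" using x by (rule energy_eq_0)
  then show "f (A i x) = f e" using \<open>f x = f e\<close> by (simp add: skew_def)
qed simp

lemma eigenfun_const: "eigenfun 1 (\<lambda>x. t)"
  using X_sum by (simp add: eigenfun_def flip: sum_distrib_right)


end

section \<open>The extremal eigenvalue \<open>1 - 2 * g\<close>\<close>

locale coxeter_perron = coxeter_action +
  fixes g :: real and h :: "real ^ 3"
  assumes g: "0 < g" and h: "\<And>j. 0 < h $ j"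
    and perron: "X $ 1 * h $ 1 - 1 / 2 * X $ 2 * h $ 2 = g * h $ 1"
      "X $ 2 * h $ 2 - 1 / 2 * X $ 1 * h $ 1 - c * X $ 3 * h $ 3 = g * h $ 2"
      "X $ 3 * h $ 3 - c * X $ 2 * h $ 2 = g * h $ 3"
begin

lemma coxeter_cos_3: "coxeter_cos 3 = 1 / 2" and coxeter_cos_2: "coxeter_cos 2 = 0"
  by (simp_all add: coxeter_cos_def)

lemma ip_skew_ge:
  "- (1 / 2) * (nrm K (skew f 1) * nrm K (skew f 2)) \<le> ip K (skew f 1) (skew f 2)"
  "- c * (nrm K (skew f 2) * nrm K (skew f 3)) \<le> ip K (skew f 2) (skew f 3)"
  "0 \<le> ip K (skew f 1) (skew f 3)"
  using involution_pair.ip_projections(1)[OF pair, of 1 2 f]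
    involution_pair.ip_projections(1)[OF pair, of 2 3 f]
    involution_pair.ip_projections(1)[OF pair, of 1 3 f]
  by (simp_all add: skew_def[abs_def] path_matrix_simps coxeter_cos_2 coxeter_cos_3)

text \<open>An identity rather than an inequality: the five terms on the right are nonnegative,
  which gives the bound on \<open>\<mu>\<close>, and at \<open>\<mu> = 1 - 2 * g\<close> each of
  them must vanish separately.\<close>

lemma energy_gap:
  assumes ev: "eigenfun \<mu> f"
  defines "d \<equiv> \<lambda>j. nrm K (skew f j)"
  shows "((1 - \<mu>) / 2 - g) * energy f =
      1 / 2 * X $ 1 * X $ 2 * h $ 1 * h $ 2 * (d 1 / h $ 1 - d 2 / h $ 2)\<^sup>2
    + c * X $ 2 * X $ 3 * h $ 2 * h $ 3 * (d 2 / h $ 2 - d 3 / h $ 3)\<^sup>2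
    + 2 * X $ 1 * X $ 2 * (ip K (skew f 1) (skew f 2) + 1 / 2 * (d 1 * d 2))
    + 2 * X $ 2 * X $ 3 * (ip K (skew f 2) (skew f 3) + c * (d 2 * d 3))
    + 2 * X $ 1 * X $ 3 * ip K (skew f 1) (skew f 3)"
proof -
  have hd: "d j / h $ j * h $ j = d j" for j using h[of j] by simp
  show ?thesis
    using ground_state_identity[OF perron, of "d 1 / h $ 1" "d 2 / h $ 2" "d 3 / h $ 3"]
      energy_eq_ip[OF ev]
    unfolding hd by (simp add: energy_def d_def algebra_simps)
qed

lemma gap_terms_nonneg:
  "0 \<le> 1 / 2 * X $ 1 * X $ 2 * h $ 1 * h $ 2 * (r - s)\<^sup>2"
  "0 \<le> c * X $ 2 * X $ 3 * h $ 2 * h $ 3 * (r - s)\<^sup>2"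
  "0 \<le> 2 * X $ 1 * X $ 2 * (ip K (skew f 1) (skew f 2) + 1 / 2 * (nrm K (skew f 1) * nrm K (skew f 2)))"
  "0 \<le> 2 * X $ 2 * X $ 3 * (ip K (skew f 2) (skew f 3) + c * (nrm K (skew f 2) * nrm K (skew f 3)))"
  "0 \<le> 2 * X $ 1 * X $ 3 * ip K (skew f 1) (skew f 3)"
  using ip_skew_ge[of f] X_pos[THEN less_imp_le] h[THEN less_imp_le] coxeter_cos_nonneg[of q]
  by (intro mult_nonneg_nonneg; simp)+

lemma energy_gap_nonneg:
  assumes "eigenfun \<mu> f"
  shows "0 \<le> ((1 - \<mu>) / 2 - g) * energy f"
  unfolding energy_gap[OF assms] by (intro add_nonneg_nonneg gap_terms_nonneg)

lemma eigenfun_le: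
  assumes ev: "eigenfun \<mu> f" and x: "x \<in> K" "f x \<noteq> 0" and "\<mu> \<noteq> 1"
  shows "\<mu> \<le> 1 - 2 * g"
proof -
  have "ip K f f \<noteq> 0" using ip_self_eq_0[OF fin] x by blast
  then have "energy f \<noteq> 0" using energy_eq[OF ev] \<open>\<mu> \<noteq> 1\<close> by auto
  then have "0 < energy f" using energy_nonneg[of f] by simp
  then have "0 \<le> (1 - \<mu>) / 2 - g" using energy_gap_nonneg[OF ev] by (simp add: zero_le_mult_iff)
  then show ?thesis by simp
qed

lemma extremal_skew:
  assumes ev: "eigenfun (1 - 2 * g) f"
  obtains t where "\<And>j. nrm K (skew f j) = t * h $ j"
    "\<And>i j. i \<noteq> j \<Longrightarrow> ip K (skew f i) (skew f j) =
      - coxeter_cos (path_matrix 3 q i j) * (nrm K (skew f i) * nrm K (skew f j))"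
proof -
  define d where "d j = nrm K (skew f j)" for j
  let ?e = "\<lambda>j. d j / h $ j"
  define T1 where "T1 = 1 / 2 * X $ 1 * X $ 2 * h $ 1 * h $ 2 * (?e 1 - ?e 2)\<^sup>2"
  define T2 where "T2 = c * X $ 2 * X $ 3 * h $ 2 * h $ 3 * (?e 2 - ?e 3)\<^sup>2"
  define T3 where "T3 = 2 * X $ 1 * X $ 2 * (ip K (skew f 1) (skew f 2) + 1 / 2 * (d 1 * d 2))"
  define T4 where "T4 = 2 * X $ 2 * X $ 3 * (ip K (skew f 2) (skew f 3) + c * (d 2 * d 3))"
  define T5 where "T5 = 2 * X $ 1 * X $ 3 * ip K (skew f 1) (skew f 3)"
  note T = T1_def T2_def T3_def T4_def T5_def
  have "T1 + T2 + T3 + T4 + T5 = 0"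
    using energy_gap[OF ev] by (simp add: T d_def)
  moreover have "0 \<le> T1" "0 \<le> T2" "0 \<le> T3" "0 \<le> T4" "0 \<le> T5"
    unfolding T d_def by (rule gap_terms_nonneg)+
  ultimately have 0: "T1 = 0" "T2 = 0" "T3 = 0" "T4 = 0" "T5 = 0" by linarith+
  have X: "X $ j \<noteq> 0" and h0: "h $ j \<noteq> 0" for j using X_pos[of j] h[of j] by simp_all
  have "?e 1 = ?e 2" "?e 2 = ?e 3"
    using 0(1,2) X h0 coxeter_cos_bounds(1)[OF q] by (auto simp: T)
  then have e: "?e j = ?e 1" for j using exhaust_3[of j] by auto
  have A: "d j = ?e 1 * h $ j" for j using e[of j] h0[of j] by (simp add: field_simps)
  have B: "ip K (skew f i) (skew f j) = - coxeter_cos (path_matrix 3 q i j) * (d i * d j)"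
    if ij: "i \<noteq> j" for i j
  proof -
    have "ip K (skew f 1) (skew f 2) = - coxeter_cos 3 * (d 1 * d 2)"
      "ip K (skew f 2) (skew f 3) = - c * (d 2 * d 3)"
      "ip K (skew f 1) (skew f 3) = - coxeter_cos 2 * (d 1 * d 3)"
      using 0(3-5) X by (auto simp: T coxeter_cos_2 coxeter_cos_3)
    note 1 = this
    have "ip K (skew f j) (skew f i) = - r * (d j * d i)"
      if "ip K (skew f i) (skew f j) = - r * (d i * d j)" for i j r
      using that ip_commute[of K "skew f j" "skew f i"] mult.commute[of "d j" "d i"] by simp
    note 2 = this[OF 1(1)] this[OF 1(2)] this[OF 1(3)]
    consider "i = 1 \<and> j = 2" | "i = 2 \<and> j = 3" | "i = 1 \<and> j = 3"
      | "i = 2 \<and> j = 1" | "i = 3 \<and> j = 2" | "i = 3 \<and> j = 1"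
      using ij exhaust_3[of i] exhaust_3[of j] by metis
    then show ?thesis
      by cases (use 1 2 in \<open>simp_all only: path_matrix_simps\<close>)
  qed
  show ?thesis by (rule that[OF A[unfolded d_def] B[unfolded d_def]])
qed

text \<open>Sharpness in the dihedral estimate makes the odd part of \<open>skew f j\<close> under
  \<open>A i\<close> a multiple of \<open>skew f i\<close>. As the norms are proportional to
  \<open>h\<close>, the factor depends on \<open>f\<close> no longer.\<close>

lemma extremal_skew_A:
  assumes ev: "eigenfun (1 - 2 * g) f" and x: "x \<in> K"
  shows "skew f j (A i x) = skew f j x - 2 * a i j * (h $ j / h $ i) * skew f i x"
proof (cases "i = j")
  case True
  have "h $ j \<noteq> 0" using h[of j] by simp
  then show ?thesis using True by (simp add: skew_A gram_def)
next
  case False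
  obtain t where t: "\<And>j. nrm K (skew f j) = t * h $ j" and ip: "ip K (skew f j) (skew f i) =
      - coxeter_cos (path_matrix 3 q j i) * (nrm K (skew f j) * nrm K (skew f i))"
    using extremal_skew[OF ev] False by metis
  show ?thesis
  \<comment> \<open>The common factor \<open>t\<close> of the norms has to be cancelled; if it is
    zero, so is the energy, and both sides vanish.\<close>
  proof (cases "t = 0")
    case True
    then have "energy f = 0" by (simp add: energy_def t)
    then show ?thesis using energy_eq_0 x AK by simp
  next
    case t0: False
    have "nrm K (skew f i) * ((skew f j x - skew f j (A i x)) / 2)
        = - coxeter_cos (path_matrix 3 q j i) * nrm K (skew f j) * skew f i x"
      using involution_pair.ip_projections(2)[OF pair, of j i f x] ip False x
      by (simp add: skew_def[abs_def])
    moreover have "coxeter_cos (path_matrix 3 q j i) = - a i j"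
      using False by (auto simp: gram_def path_matrix_def insert_commute)
    ultimately have "t * (h $ i * ((skew f j x - skew f j (A i x)) / 2)) = t * (a i j * h $ j * skew f i x)"
      by (simp add: t algebra_simps)
    then have "h $ i * ((skew f j x - skew f j (A i x)) / 2) = a i j * h $ j * skew f i x"
      by (simp only: mult_left_cancel[OF t0])
    then show ?thesis using h[of i] by (simp add: field_simps)
  qed
qed

text \<open>The three values \<open>skew f j x\<close> propagate linearly along the edges, so their
  vanishing at \<open>e\<close> spreads over \<open>K\<close>. Their weighted sum is
  \<open>g * f x\<close> with \<open>g\<close> nonzero, which recovers \<open>f\<close>.\<close>

lemma extremal_eq_0:
  assumes ev: "eigenfun (1 - 2 * g) f" and 0: "\<And>j. skew f j e = 0" and x: "x \<in> K"
  shows "f x = 0"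
proof -
  have "\<forall>j. skew f j x = 0"
    using _ _ x
    by (rule induct[of "\<lambda>x. \<forall>j. skew f j x = 0"]) (use 0 extremal_skew_A[OF ev] in auto)
  then show ?thesis using eigenfun_skew[OF ev x] g by simp
qed

section \<open>The three eigenfunctions from the reflection representation\<close>

definition F :: "3 \<Rightarrow> 'a \<Rightarrow> real" where
  "F k x = \<rho> x h $ k"

text \<open>The Perron equations say that \<open>h\<close> is an eigenvector of the weighted sum of
  the reflections, with eigenvalue \<open>1 - 2 * g\<close>. Applying the linear map
  \<open>\<rho> x\<close> turns this into the eigenvalue equation at \<open>x\<close>.\<close>

lemma eigenfun_F: "eigenfun (1 - 2 * g) (F k)"
  unfolding eigenfun_def
proof
  fix x assume x: "x \<in> K"
  interpret linear "\<rho> x" by (rule lin[OF x])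
  have *: "(\<Sum>j\<in>UNIV. X $ j *\<^sub>R reflect (path_matrix 3 q) j h) = (1 - 2 * g) *\<^sub>R h"
  proof (simp only: vec_eq_iff, intro allI)
    fix k
    have "X $ 1 * a 1 k * h $ 1 + X $ 2 * a 2 k * h $ 2 + X $ 3 * a 3 k * h $ 3 = g * h $ k"
      using exhaust_3[of k] perron by (auto simp: gram_path mult.commute)
    moreover have "(\<Sum>j\<in>UNIV. X $ j *\<^sub>R reflect (path_matrix 3 q) j h) $ k = (X $ 1 + X $ 2 + X $ 3) * h $ k
        - 2 * (X $ 1 * a 1 k * h $ 1 + X $ 2 * a 2 k * h $ 2 + X $ 3 * a 3 k * h $ 3)"
      by (simp add: sum_3 reflect_def algebra_simps)
    ultimately have "(\<Sum>j\<in>UNIV. X $ j *\<^sub>R reflect (path_matrix 3 q) j h) $ k = 1 * h $ k - 2 * (g * h $ k)"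
      unfolding X_sum3 by (simp only:)
    then show "(\<Sum>j\<in>UNIV. X $ j *\<^sub>R reflect (path_matrix 3 q) j h) $ k = ((1 - 2 * g) *\<^sub>R h) $ k"
      by (simp only: vector_scaleR_component) (simp add: algebra_simps)
  qed
  have "(\<Sum>j\<in>UNIV. X $ j * F k (A j x)) = \<rho> x (\<Sum>j\<in>UNIV. X $ j *\<^sub>R reflect (path_matrix 3 q) j h) $ k"
    by (simp add: F_def \<rho>_A[OF x] sum scaleR)
  also have "\<dots> = (1 - 2 * g) * F k x"
    by (simp add: * scaleR F_def)
  finally show "(\<Sum>j\<in>UNIV. X $ j * F k (A j x)) = (1 - 2 * g) * F k x" .
qed

text \<open>The values of the \<open>skew (F k) j\<close> at \<open>e\<close> form the matrix
  \<open>diag(h) a\<close>. Its invertibility gives both the independence of the \<open>F k\<close>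
  and the spanning property.\<close>

lemma skew_F: "skew (F k) j e = a j k * h $ j"
  by (simp add: skew_def F_def \<rho>_A[OF e] \<rho>_e reflect_def)

lemma gram_solve:
  obtains u :: "3 \<Rightarrow> real" where "\<And>j. (\<Sum>k\<in>UNIV. a j k * u k) = b j"
proof -
  define D where "D = 1 - (1 / 2)\<^sup>2 - c\<^sup>2"
  have D: "D \<noteq> 0" using coxeter_cos_bounds(2)[OF q] by (simp add: D_def)
  \<comment> \<open>The adjugate of the Gram matrix applied to \<open>b\<close>; \<open>D\<close> is
    the determinant.\<close>
  define v where "v k = (if k = 1 then (1 - c\<^sup>2) * b 1 + 1 / 2 * b 2 + 1 / 2 * c * b 3
    else if k = 2 then 1 / 2 * b 1 + b 2 + c * b 3
    else 1 / 2 * c * b 1 + c * b 2 + 3 / 4 * b 3)" for k :: 3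
  have "(\<Sum>k\<in>UNIV. a j k * v k) = D * b j" for j
    using exhaust_3[of j]
    by (auto simp: sum_3 gram_path v_def D_def power2_eq_square algebra_simps simp del: One_nat_def)
  then have "(\<Sum>k\<in>UNIV. a j k * (v k / D)) = b j" for j
    using D by (simp flip: sum_divide_distrib)
  then show ?thesis using that[of "\<lambda>k. v k / D"] by blast
qed

lemma gram_kernel:
  assumes "\<And>j. (\<Sum>k\<in>UNIV. a j k * u k) = 0"
  shows "u k = 0"
proof -
  have 1: "u 1 = u 2 / 2" "u 3 = c * u 2" "u 2 = u 1 / 2 + c * u 3"
    using assms[of 1] assms[of 2] assms[of 3] by (simp_all add: sum_3 gram_path)
  then have "u 2 = (u 2 / 2) / 2 + c * (c * u 2)" by metis
  moreover have "u 2 * (1 - (1 / 2)\<^sup>2 - c\<^sup>2) = u 2 - ((u 2 / 2) / 2 + c * (c * u 2))"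
    by (simp add: power2_eq_square algebra_simps)
  ultimately have "u 2 * (1 - (1 / 2)\<^sup>2 - c\<^sup>2) = 0" by linarith
  then have "u 2 = 0" using coxeter_cos_bounds(2)[OF q] by simp
  moreover from this have "u 1 = 0" "u 3 = 0" using 1(1,2) by simp_all
  ultimately show ?thesis using exhaust_3[of k] by auto
qed

lemma F_independent:
  assumes 0: "\<And>x. x \<in> K \<Longrightarrow> (\<Sum>k\<in>UNIV. u k * F k x) = 0"
  shows "u k = 0"
proof (rule gram_kernel)
  fix j
  have "(\<Sum>k\<in>UNIV. u k * skew (F k) j e) = ((\<Sum>k\<in>UNIV. u k * F k e) - (\<Sum>k\<in>UNIV. u k * F k (A j e))) / 2"
    by (simp add: sum_3 skew_def field_simps)
  also have "\<dots> = 0" using 0 e AK by simp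
  finally have "h $ j * (\<Sum>k\<in>UNIV. a j k * u k) = 0"
    by (simp add: skew_F sum_3 algebra_simps)
  then show "(\<Sum>k\<in>UNIV. a j k * u k) = 0" using h[of j] by simp
qed

text \<open>A combination of the \<open>F k\<close> can be chosen with the same three initial values
  \<open>skew f j e\<close>, and the difference is then zero by
  \<open>extremal_eq_0\<close>.\<close>

lemma eigenfun_span_F:
  assumes ev: "eigenfun (1 - 2 * g) f"
  obtains u where "\<And>x. x \<in> K \<Longrightarrow> f x = (\<Sum>k\<in>UNIV. u k * F k x)"
proof -
  obtain u where u: "\<And>j. (\<Sum>k\<in>UNIV. a j k * u k) = skew f j e / h $ j"
    using gram_solve[of "\<lambda>j. skew f j e / h $ j"] by blast
  let ?f = "\<lambda>x. f x - (u 1 * F 1 x + u 2 * F 2 x + u 3 * F 3 x)"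
  have "eigenfun (1 - 2 * g) ?f"
    unfolding eigenfun_def
  proof
    fix x assume "x \<in> K"
    then have "X $ 1 * F k (A 1 x) + X $ 2 * F k (A 2 x) + X $ 3 * F k (A 3 x) = (1 - 2 * g) * F k x" 
      and "X $ 1 * f (A 1 x) + X $ 2 * f (A 2 x) + X $ 3 * f (A 3 x) = (1 - 2 * g) * f x" for k
      using eigenfun_F[of k] ev by (simp_all add: eigenfun_def sum_3)
    note E = this(2) this(1)[of 1] this(1)[of 2] this(1)[of 3]
    have "(\<Sum>j\<in>UNIV. X $ j * ?f (A j x)) = (X $ 1 * f (A 1 x) + X $ 2 * f (A 2 x) + X $ 3 * f (A 3 x))
       - u 1 * (X $ 1 * F 1 (A 1 x) + X $ 2 * F 1 (A 2 x) + X $ 3 * F 1 (A 3 x))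
       - u 2 * (X $ 1 * F 2 (A 1 x) + X $ 2 * F 2 (A 2 x) + X $ 3 * F 2 (A 3 x))
       - u 3 * (X $ 1 * F 3 (A 1 x) + X $ 2 * F 3 (A 2 x) + X $ 3 * F 3 (A 3 x))"
      by (simp add: sum_3 algebra_simps)
    then show "(\<Sum>j\<in>UNIV. X $ j * ?f (A j x)) = (1 - 2 * g) * ?f x"
      unfolding E by (simp add: algebra_simps)
  qed
  moreover have "skew ?f j e = 0" for j
  proof -
    have "skew ?f j e = skew f j e - h $ j * (\<Sum>k\<in>UNIV. a j k * u k)"
      using skew_F[of 1 j] skew_F[of 2 j] skew_F[of 3 j]
      by (simp add: skew_def sum_3 field_simps)
    then show ?thesis using u[of j] h[of j] by simp
  qed
  ultimately have "?f x = 0" if "x \<in> K" for x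
    using that by (rule extremal_eq_0)
  then show ?thesis using that[of u] by (simp add: sum_3)
qed

end

section \<open>The reflection representation\<close>

lemma reflect_nth_path:
  fixes q :: nat defines "m \<equiv> path_matrix 3 q" and "t \<equiv> 2 * coxeter_cos q"
  shows "reflect m 1 h $ 1 = - h $ 1" "reflect m 1 h $ 2 = h $ 2 + h $ 1" "reflect m 1 h $ 3 = h $ 3"
    "reflect m 2 h $ 1 = h $ 1 + h $ 2" "reflect m 2 h $ 2 = - h $ 2" "reflect m 2 h $ 3 = h $ 3 + t * h $ 2"
    "reflect m 3 h $ 1 = h $ 1" "reflect m 3 h $ 2 = h $ 2 + t * h $ 3" "reflect m 3 h $ 3 = - h $ 3"
  by (simp_all add: reflect_def m_def t_def gram_path)

lemma reflect_reflect: "reflect m i (reflect m i h) = h"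
  by (simp add: vec_eq_iff reflect_def gram_def algebra_simps)

lemma reflect_rel_swap:
  assumes "\<And>h. ((reflect m i \<circ> reflect m j) ^^ n) h = h" and "n \<in> {2, 3, 4, 5}"
  shows "((reflect m j \<circ> reflect m i) ^^ n) h = h"
proof -
  \<comment> \<open>the carrier plays no role for the relations\<close>
  interpret involution_pair "{}" "reflect m i" "reflect m j" n
    by unfold_locales (use assms in \<open>auto simp: reflect_reflect\<close>)
  interpret swap: involution_pair "{}" "reflect m j" "reflect m i" n by (rule swap)
  show ?thesis by (rule swap.rel)
qed

text \<open>\<open>f\<close> has the form of a product of two reflections, with \<open>t\<close> in
  the role of \<open>2 cos (pi / q)\<close>. The hypotheses are the minimal polynomials of that
  number for \<open>q = 3, 4, 5\<close>, so the powers can be computed by pure algebra.\<close>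

lemma rotation_pow:
  fixes f :: "real ^ 3 \<Rightarrow> real ^ 3"
  assumes f: "\<And>h. f h $ 1 = h $ 1 + h $ 2 + t * h $ 3" "\<And>h. f h $ 2 = - h $ 2 - t * h $ 3"
    "\<And>h. f h $ 3 = t * h $ 2 + (t * t - 1) * h $ 3"
  shows "t = 1 \<Longrightarrow> (f ^^ 3) h = h" and "t * t = 2 \<Longrightarrow> (f ^^ 4) h = h"
    and "t * t = t + 1 \<Longrightarrow> (f ^^ 5) h = h"
proof -
  show "(f ^^ 3) h = h" if "t = 1"
    using that by (simp add: vec_eq_iff forall_3 eval_nat_numeral f)
  show "(f ^^ 4) h = h" if t: "t * t = 2"
  proof -
    have tt: "t * (t * x) = 2 * x" for x using t by (simp flip: mult.assoc)
    show ?thesis by (simp add: vec_eq_iff forall_3 eval_nat_numeral f tt t algebra_simps)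
  qed
  show "(f ^^ 5) h = h" if t: "t * t = t + 1"
  proof -
    have tt: "t * (t * x) = t * x + x" for x using t by (simp add: distrib_right flip: mult.assoc)
    show ?thesis by (simp add: vec_eq_iff forall_3 eval_nat_numeral f tt t algebra_simps)
  qed
qed

lemma reflect_rel_23:
  assumes "q \<in> {3, 4, 5}"
  shows "((reflect (path_matrix 3 q) 2 \<circ> reflect (path_matrix 3 q) 3) ^^ q) h = h"
proof -
  define t where "t = 2 * coxeter_cos q"
  define f where "f = reflect (path_matrix 3 q) 2 \<circ> reflect (path_matrix 3 q) 3"
  have f: "f h $ 1 = h $ 1 + h $ 2 + t * h $ 3" "f h $ 2 = - h $ 2 - t * h $ 3"
    "f h $ 3 = t * h $ 2 + (t * t - 1) * h $ 3" for h
    by (simp_all add: f_def reflect_nth_path t_def algebra_simps)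
  from assms consider "q = 3" "t = 1" | "q = 4" "t * t = 2" | "q = 5" "t * t = t + 1"
    by (auto simp: t_def coxeter_cos_def field_simps)
  then show ?thesis
    unfolding f_def[symmetric] by cases (simp_all only: rotation_pow[OF f])
qed

lemma reflect_rel:
  assumes q: "q \<in> {3, 4, 5}"
  defines "m \<equiv> path_matrix 3 q"
  shows "((reflect m i \<circ> reflect m j) ^^ m i j) h = h"
proof -
  have 12: "((reflect m 1 \<circ> reflect m 2) ^^ 3) h = h"
    and 13: "((reflect m 1 \<circ> reflect m 3) ^^ 2) h = h" for h
    by (simp_all add: vec_eq_iff forall_3 eval_nat_numeral reflect_nth_path[of q, folded m_def] algebra_simps)
  have 23: "((reflect m 2 \<circ> reflect m 3) ^^ q) h = h" for h
    unfolding m_def by (rule reflect_rel_23[OF q])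
  have 21: "((reflect m 2 \<circ> reflect m 1) ^^ 3) h = h"
    and 31: "((reflect m 3 \<circ> reflect m 1) ^^ 2) h = h"
    and 32: "((reflect m 3 \<circ> reflect m 2) ^^ q) h = h"
    using q by (auto intro!: reflect_rel_swap 12 13 23)
  consider "i = j" | "i = 1 \<and> j = 2" | "i = 2 \<and> j = 3" | "i = 1 \<and> j = 3"
      | "i = 2 \<and> j = 1" | "i = 3 \<and> j = 2" | "i = 3 \<and> j = 1"
    using exhaust_3[of i] exhaust_3[of j] by metis
  then show ?thesis
    by cases (use 12 13 23 21 31 32 in \<open>simp_all add: path_matrix_simps reflect_reflect m_def\<close>)
qed

lemma foldr_concat_replicate:
  "foldr f (concat (replicate n [i, j])) x = ((f i \<circ> f j) ^^ n) x"
  by (induction n) auto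

text \<open>The universal property of the presentation: composing maps respects the congruence once
  the relators act trivially.\<close>

lemma coxeter_eq_foldr:
  assumes "coxeter_eq m u v" and "\<And>i j x. ((f i \<circ> f j) ^^ m i j) x = x"
  shows "foldr f u = foldr f v"
  using assms(1)
proof induction
  case (relator i j)
  then show ?case using assms(2) by (simp add: fun_eq_iff foldr_concat_replicate)
qed (simp_all add: fun_eq_iff)

lemma linear_reflect: "linear (reflect m i)"
  by (rule linearI) (simp_all add: vec_eq_iff reflect_def algebra_simps)

lemma linear_foldr_reflect: "linear (foldr (reflect m) w)"
proof (induction w)
  case Nil
  then show ?case using linear_id by (simp add: id_def)
next
  case (Cons i w)
  have "foldr (reflect m) (i # w) = reflect m i \<circ> foldr (reflect m) w" by (simp add: fun_eq_iff)
  then show ?case using linear_compose[OF Cons linear_reflect[of m i]] by (simp only:)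
qed

section \<open>Coxeter groups acting by right multiplication\<close>

text \<open>The identity is the default outside the carrier, so that involutivity and the Coxeter
  relations hold on the whole type.\<close>

definition right_mult :: "('a, 'b) monoid_scheme \<Rightarrow> 'a \<Rightarrow> 'a \<Rightarrow> 'a" where
  "right_mult G g x = (if x \<in> carrier G then x \<otimes>\<^bsub>G\<^esub> g else x)"

locale coxeter_group =
  fixes G :: "'a monoid" and s :: "3 \<Rightarrow> 'a" and q :: nat
  assumes q: "q \<in> {3, 4, 5}" and cs: "coxeter_system G s (path_matrix 3 q)"
begin

sublocale group G using cs by (simp add: coxeter_system_def)

lemma s_closed: "s i \<in> carrier G"
  using cs by (auto simp: coxeter_system_def)

lemma word_val_Nil: "word_val G s [] = \<one>\<^bsub>G\<^esub>"
  and word_val_Cons: "word_val G s (i # w) = s i \<otimes>\<^bsub>G\<^esub> word_val G s w"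
  by (simp_all add: word_val_def)

lemma word_val_closed: "word_val G s w \<in> carrier G"
  by (induction w) (simp_all add: word_val_Nil word_val_Cons s_closed)

lemma word_val_append: "word_val G s (u @ v) = word_val G s u \<otimes>\<^bsub>G\<^esub> word_val G s v"
  by (induction u) (simp_all add: word_val_Nil word_val_Cons s_closed word_val_closed m_assoc)

lemma word_val_eq_iff: "word_val G s u = word_val G s v \<longleftrightarrow> coxeter_eq (path_matrix 3 q) u v"
  using cs by (simp add: coxeter_system_def)

lemma s_s: "s i \<otimes>\<^bsub>G\<^esub> s i = \<one>\<^bsub>G\<^esub>"
proof -
  have "coxeter_eq (path_matrix 3 q) (concat (replicate (path_matrix 3 q i i) [i, i])) []"
    by (rule coxeter_eq.relator)
  then have "word_val G s [i, i] = word_val G s []"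
    unfolding word_val_eq_iff by (simp add: path_matrix_simps)
  then show ?thesis by (simp add: word_val_Nil word_val_Cons s_closed)
qed

lemma carrier_word: "x \<in> carrier G \<Longrightarrow> \<exists>w. x = word_val G s w"
proof -
  have inv: "inv\<^bsub>G\<^esub> s i = s i" for i by (rule inv_equality) (simp_all add: s_s s_closed)
  have s: "\<exists>w. s i = word_val G s w" for i
    by (rule exI[of _ "[i]"]) (simp add: word_val_Nil word_val_Cons s_closed)
  assume "x \<in> carrier G"
  then have "x \<in> generate G (range s)" using cs by (simp add: coxeter_system_def)
  then show ?thesis
  proof induction
    case one
    then show ?case by (metis word_val_Nil)
  next
    case (incl h)
    then show ?case using s by auto
  next
    case (inv h)
    then show ?case using s \<open>\<And>i. inv\<^bsub>G\<^esub> s i = s i\<close> by auto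
  next
    case (eng h1 h2)
    then show ?case by (metis word_val_append)
  qed
qed

abbreviation "A i \<equiv> right_mult G (s i)"

lemma A_closed: "x \<in> carrier G \<Longrightarrow> A i x \<in> carrier G"
  by (simp add: right_mult_def s_closed)

lemma A_A: "A i (A i x) = x"
  by (simp add: right_mult_def s_closed m_assoc s_s)

lemma A_word: "A i (word_val G s w) = word_val G s (w @ [i])"
  by (simp add: right_mult_def word_val_append word_val_closed word_val_Nil word_val_Cons s_closed)

lemma carrier_induct:
  assumes "P \<one>\<^bsub>G\<^esub>" and "\<And>x i. x \<in> carrier G \<Longrightarrow> P x \<Longrightarrow> P (A i x)" and x: "x \<in> carrier G"
  shows "P x"
proof -
  have "P (word_val G s w)" for w
  proof (induction w rule: rev_induct)
    case Nil
    then show ?case using assms(1) by (simp add: word_val_Nil)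
  next
    case (snoc i w)
    then show ?case using assms(2)[OF word_val_closed, of w i] by (simp add: A_word)
  qed
  then show ?thesis using carrier_word[OF x] by blast
qed

lemma A_rel: "((A i \<circ> A j) ^^ path_matrix 3 q i j) x = x"
proof (cases "x \<in> carrier G")
  case True
  \<comment> \<open>Right translations compose in reverse order, so the relator that occurs is the
    one for \<open>j, i\<close>; the Coxeter matrix is symmetric.\<close>
  have "((A i \<circ> A j) ^^ n) y = y \<otimes>\<^bsub>G\<^esub> word_val G s (concat (replicate n [j, i]))"
    if "y \<in> carrier G" for n y
    using that
  proof (induction n arbitrary: y)
    case (Suc n)
    have "((A i \<circ> A j) ^^ Suc n) y = ((A i \<circ> A j) ^^ n) (A i (A j y))" by (simp add: funpow_swap1)
    also have "\<dots> = A i (A j y) \<otimes>\<^bsub>G\<^esub> word_val G s (concat (replicate n [j, i]))"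
      using Suc.IH[of "A i (A j y)"] Suc.prems by (simp only: A_closed)
    also have "\<dots> = y \<otimes>\<^bsub>G\<^esub> word_val G s (concat (replicate (Suc n) [j, i]))"
      using Suc.prems by (simp add: right_mult_def s_closed word_val_closed word_val_Cons m_assoc)
    finally show ?case .
  qed (simp add: word_val_Nil)
  moreover have "word_val G s (concat (replicate (path_matrix 3 q j i) [j, i])) = word_val G s []"
    unfolding word_val_eq_iff by (rule coxeter_eq.relator)
  moreover have "path_matrix 3 q i j = path_matrix 3 q j i"
    by (auto simp: path_matrix_def insert_commute)
  ultimately show ?thesis using True by (simp add: word_val_Nil)
next
  case False
  then have "((A i \<circ> A j) ^^ n) x = x" for n by (induction n) (simp_all add: right_mult_def)
  then show ?thesis .
qed

text \<open>Coset enumeration yields some finite set that contains the identity and is closed under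
  the translations; induction along generators shows that the carrier lies inside it.\<close>

lemma finite_carrier: "finite (carrier G)"
proof -
  have "\<exists>K. finite K \<and> \<one>\<^bsub>G\<^esub> \<in> K \<and> (\<forall>i. \<forall>h\<in>K. A i h \<in> K)"
    using A_A _ _ q
  proof (rule finite_orbit_rank3)
    show "((A 1 \<circ> A 2) ^^ 3) x = x" "((A 1 \<circ> A 3) ^^ 2) x = x" "((A 2 \<circ> A 3) ^^ q) x = x" for x
      using A_rel[of 1 2 x] A_rel[of 1 3 x] A_rel[of 2 3 x] by (simp_all only: path_matrix_simps)
  qed
  then obtain K where K: "finite K" "\<one>\<^bsub>G\<^esub> \<in> K" "\<And>i h. h \<in> K \<Longrightarrow> A i h \<in> K" by blast
  have "x \<in> K" if "x \<in> carrier G" for x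
    using K(2) _ that by (rule carrier_induct) (rule K(3))
  then show ?thesis using K(1) by (meson finite_subset subsetI)
qed

text \<open>Any word for a group element may be chosen, because words with equal value are
  congruent. This is where the Coxeter relations must imply all other relations.\<close>

lemma reflection_representation:
  obtains \<rho> where "\<And>w. \<rho> (word_val G s w) = foldr (reflect (path_matrix 3 q)) w"
proof
  fix w
  have "coxeter_eq (path_matrix 3 q) (SOME v. word_val G s v = word_val G s w) w"
    unfolding word_val_eq_iff[symmetric] by (rule someI) (rule HOL.refl)
  then show "(\<lambda>x. foldr (reflect (path_matrix 3 q)) (SOME v. word_val G s v = x)) (word_val G s w)
      = foldr (reflect (path_matrix 3 q)) w"
    using coxeter_eq_foldr[of "path_matrix 3 q" _ _ "reflect (path_matrix 3 q)"] reflect_rel[OF q]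
    by blast
qed

lemma coxeter_action:
  assumes "X \<in> int_Delta"
  obtains \<rho> where "coxeter_action (carrier G) \<one>\<^bsub>G\<^esub> A q \<rho> X"
proof -
  obtain \<rho> where \<rho>: "\<And>w. \<rho> (word_val G s w) = foldr (reflect (path_matrix 3 q)) w"
    using reflection_representation by blast
  have "coxeter_action (carrier G) \<one>\<^bsub>G\<^esub> A q \<rho> X"
  proof (rule coxeter_action.intro)
    show "linear (\<rho> x)" if "x \<in> carrier G" for x
      using carrier_word[OF that] linear_foldr_reflect by (auto simp: \<rho>)
    show "\<rho> \<one>\<^bsub>G\<^esub> = id" using \<rho>[of "[]"] by (simp add: word_val_Nil)
    show "\<rho> (A i x) h = \<rho> x (reflect (path_matrix 3 q) i h)" if "x \<in> carrier G" for x i h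
      using carrier_word[OF that] by (auto simp: \<rho> A_word)
    show "P x" if "P \<one>\<^bsub>G\<^esub>" "\<And>x i. x \<in> carrier G \<Longrightarrow> P x \<Longrightarrow> P (A i x)" "x \<in> carrier G" for P x
      using that by (rule carrier_induct)
    show "((A i \<circ> A j) ^^ path_matrix 3 q i j) x = x" for i j x by (rule A_rel)
  qed (use assms finite_carrier A_A A_closed q in \<open>auto simp: int_Delta_def Delta_def\<close>)
  then show ?thesis by (rule that)
qed

lemma eigenspace_iff:
  "f \<in> eigenspace G s X \<mu> \<longleftrightarrow> f \<in> fun_space G \<and>
    (\<forall>x\<in>carrier G. (\<Sum>j\<in>UNIV. X $ j * f (A j x)) = \<mu> * f x)"
  by (auto simp: eigenspace_def fun_space_def P_op_def fun_scale_def fun_eq_iff right_mult_def)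

end

section \<open>Multiplicities\<close>

lemma fun_sum_apply: "(\<Sum>v\<in>S. h v) x = (\<Sum>v\<in>S. h v (x :: 'a) :: real)"
  by (induction S rule: infinite_finite_induct) simp_all

text \<open>Indexing by a finite type turns the dimension into its cardinality, here that of
  \<open>unit\<close> or \<open>3\<close>. Independence is stated for families, so it also shows
  that \<open>f\<close> has no repeated values.\<close>

lemma fun_dim_eqI:
  fixes f :: "'i::finite \<Rightarrow> 'a \<Rightarrow> real"
  assumes sub: "\<And>i. f i \<in> V"
    and span: "\<And>v. v \<in> V \<Longrightarrow> \<exists>u. v = (\<lambda>x. \<Sum>i\<in>UNIV. u i * f i x)"
    and indep: "\<And>u i. (\<And>x. (\<Sum>i\<in>UNIV. u i * f i x) = 0) \<Longrightarrow> u i = 0"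
  shows "fun_vs.dim V = CARD('i)"
proof (rule fun_vs.dim_unique)
  have inj: "inj f"
  proof (rule injI, rule ccontr)
    fix i j assume eq: "f i = f j" and "i \<noteq> j"
    let ?u = "\<lambda>k. if k = i then 1 else if k = j then - 1 else (0::real)"
    have "(\<Sum>k\<in>UNIV. ?u k * f k x) = (\<Sum>k\<in>{i, j}. ?u k * f k x)" for x
      by (rule sum.mono_neutral_right) auto
    then have "(\<Sum>k\<in>UNIV. ?u k * f k x) = 0" for x using eq \<open>i \<noteq> j\<close> by simp
    then have "?u i = 0" by (rule indep)
    then show False by simp
  qed
  show "range f \<subseteq> V" using sub by blast
  show "card (range f) = CARD('i)" using inj by (simp add: card_image)
  show "V \<subseteq> fun_vs.span (range f)"
  proof
    fix v assume "v \<in> V"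
    then obtain u where "v = (\<lambda>x. \<Sum>i\<in>UNIV. u i * f i x)" using span by blast
    then have "v = (\<Sum>i\<in>UNIV. fun_scale (u i) (f i))"
      by (simp add: fun_eq_iff fun_sum_apply fun_scale_def)
    also have "\<dots> \<in> fun_vs.span (range f)"
      by (intro fun_vs.span_sum fun_vs.span_scale fun_vs.span_base) simp
    finally show "v \<in> fun_vs.span (range f)" .
  qed
  show "fun_vs.independent (range f)"
  proof
    assume "fun_vs.dependent (range f)"
    then obtain u v where v: "v \<in> range f" "u v \<noteq> 0" and 0: "(\<Sum>v\<in>range f. fun_scale (u v) v) = 0"
      using fun_vs.dependent_finite[of "range f"] by auto
    have "(\<Sum>i\<in>UNIV. u (f i) * f i x) = (\<Sum>v\<in>range f. fun_scale (u v) v) x" for x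
      by (simp add: fun_sum_apply sum.reindex[OF inj] fun_scale_def)
    then have "(\<Sum>i\<in>UNIV. u (f i) * f i x) = 0" for x by (simp add: 0)
    then have "u (f i) = 0" for i by (rule indep)
    then show False using v by auto
  qed
qed

text \<open>Pairwise orthogonal nonzero functions are independent, and all of them lie in the span
  of the finitely many point masses on \<open>K\<close>.\<close>

lemma finite_orthogonal:
  assumes "finite K" and supp: "\<And>f x. f \<in> S \<Longrightarrow> x \<notin> K \<Longrightarrow> f x = 0"
    and orth: "\<And>f g. f \<in> S \<Longrightarrow> g \<in> S \<Longrightarrow> f \<noteq> g \<Longrightarrow> ip K f g = 0"
    and nz: "\<And>f. f \<in> S \<Longrightarrow> ip K f f \<noteq> 0"
  shows "finite S"
proof -
  let ?\<delta> = "\<lambda>y x. if x = y then 1 else (0 :: real)"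
  have "fun_vs.independent S"
  proof
    assume "fun_vs.dependent S"
    then obtain T u v where T: "finite T" "T \<subseteq> S" "v \<in> T" "u v \<noteq> 0"
      and 0: "(\<Sum>v\<in>T. fun_scale (u v) v) = 0"
      unfolding fun_vs.dependent_explicit by blast
    have "0 = ip K (\<Sum>v\<in>T. fun_scale (u v) v) v" unfolding 0 by (simp add: ip_def)
    also have "\<dots> = (\<Sum>w\<in>T. u w * ip K w v)"
      unfolding ip_def fun_sum_apply sum_distrib_left sum_distrib_right
      by (subst sum.swap) (simp add: fun_scale_def mult.assoc)
    also have "\<dots> = (\<Sum>w\<in>{v}. u w * ip K w v)"
      using T orth by (intro sum.mono_neutral_right) auto
    finally show False using T nz by auto
  qed
  moreover have "S \<subseteq> fun_vs.span (?\<delta> ` K)"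
  proof
    fix f assume f: "f \<in> S"
    have "f = (\<Sum>y\<in>K. fun_scale (f y) (?\<delta> y))"
      using supp[OF f] assms(1) by (auto simp: fun_eq_iff fun_sum_apply fun_scale_def if_distrib cong: if_cong)
    also have "\<dots> \<in> fun_vs.span (?\<delta> ` K)"
      by (intro fun_vs.span_sum fun_vs.span_scale fun_vs.span_base) simp
    finally show "f \<in> fun_vs.span (?\<delta> ` K)" .
  qed
  ultimately show "finite S"
    using fun_vs.independent_span_bound[of "?\<delta> ` K" S] assms(1) by simp
qed

section \<open>Identification of the second eigenvalue\<close>

lemma (in coxeter_group) eig_mult_lambda_1:
  assumes X: "X \<in> int_Delta"
  shows "eig_mult G s X (lambda G s X 1) = 3"
proof -
  obtain \<rho> where act: "coxeter_action (carrier G) \<one>\<^bsub>G\<^esub> A q \<rho> X"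
    using coxeter_action[OF X] by blast
  interpret act: coxeter_action "carrier G" "\<one>\<^bsub>G\<^esub>" A q \<rho> X by (rule act)
  obtain g h1 h2 h3 where g: "0 < g" "0 < h1" "0 < h2" "0 < h3"
    and perron: "X $ 1 * h1 - 1 / 2 * X $ 2 * h2 = g * h1"
      "X $ 2 * h2 - 1 / 2 * X $ 1 * h1 - coxeter_cos q * X $ 3 * h3 = g * h2"
      "X $ 3 * h3 - coxeter_cos q * X $ 2 * h2 = g * h3"
    using perron_pair[OF act.X_pos act.X_pos act.X_pos half_gt_zero[OF zero_less_one] coxeter_cos_bounds[OF q]]
    by metis
  define h :: "real ^ 3" where "h = (\<chi> j. if j = 1 then h1 else if j = 2 then h2 else h3)"
  have h: "h $ 1 = h1" "h $ 2 = h2" "h $ 3 = h3" by (simp_all add: h_def)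
  interpret per: coxeter_perron "carrier G" "\<one>\<^bsub>G\<^esub>" A q \<rho> X g h
  proof unfold_locales
    show "0 < h $ j" for j using exhaust_3[of j] g h by auto
  qed (simp_all only: h g perron)
  \<comment> \<open>\<open>act.eigenfun\<close> ignores values outside the carrier, whereas elements
    of \<open>fun_space G\<close> vanish there; the constant and the \<open>per.F k\<close> are cut
    off accordingly.\<close>
  let ?res = "\<lambda>f x. if x \<in> carrier G then f x else (0 :: real)"
  have space: "f \<in> eigenspace G s X \<mu> \<longleftrightarrow> f \<in> fun_space G \<and> act.eigenfun \<mu> f" for f \<mu>
    by (simp add: eigenspace_iff act.eigenfun_def)
  have res: "?res f \<in> eigenspace G s X \<mu>" if "act.eigenfun \<mu> f" for f \<mu>
    using that A_closed by (simp add: space act.eigenfun_def fun_space_def)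
  have nz: "\<exists>x\<in>carrier G. f x \<noteq> 0" if "f \<in> fun_space G" "f \<noteq> 0" for f
    using that by (auto simp: fun_space_def fun_eq_iff)
  have mult: "\<exists>f. f \<in> eigenspace G s X \<mu> \<and> f \<noteq> 0" if "0 < eig_mult G s X \<mu>" for \<mu>
  proof (rule ccontr)
    assume "\<not> ?thesis"
    then have "eigenspace G s X \<mu> \<subseteq> fun_vs.span {}" by auto
    then have "eig_mult G s X \<mu> \<le> card ({} :: ('a \<Rightarrow> real) set)"
      unfolding eig_mult_def by (rule fun_vs.dim_le_card) simp
    then show False using that by simp
  qed
  have mult_1: "eig_mult G s X 1 = 1"
  proof -
    have "eig_mult G s X 1 = CARD(unit)"
      unfolding eig_mult_def
    proof (rule fun_dim_eqI[of "\<lambda>_. ?res (\<lambda>x. 1)"])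
      show "?res (\<lambda>x. 1) \<in> eigenspace G s X 1" by (rule res[OF act.eigenfun_const])
      show "\<exists>u. v = (\<lambda>x. \<Sum>i\<in>(UNIV :: unit set). u i * ?res (\<lambda>x. 1) x)"
        if v: "v \<in> eigenspace G s X 1" for v
      proof (intro exI ext)
        show "v x = (\<Sum>i\<in>(UNIV :: unit set). v \<one>\<^bsub>G\<^esub> * ?res (\<lambda>x. 1) x)" for x
        proof (cases "x \<in> carrier G")
          case True
          then have "v x = v \<one>\<^bsub>G\<^esub>" using v space act.eigenfun_1_const by blast
          then show ?thesis using True by (simp add: UNIV_unit)
        qed (use v in \<open>simp add: space fun_space_def\<close>)
      qed
      show "u i = 0" if "\<And>x. (\<Sum>i\<in>(UNIV :: unit set). u i * ?res (\<lambda>x. 1) x) = 0" for u and i :: unit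
        using that[of "\<one>\<^bsub>G\<^esub>"] by (simp add: UNIV_unit)
    qed
    then show ?thesis by simp
  qed
  have mult_3: "eig_mult G s X (1 - 2 * g) = 3"
  proof -
    have "eig_mult G s X (1 - 2 * g) = CARD(3)"
      unfolding eig_mult_def
    proof (rule fun_dim_eqI[of "\<lambda>k. ?res (per.F k)"])
      show "?res (per.F k) \<in> eigenspace G s X (1 - 2 * g)" for k
        by (rule res[OF per.eigenfun_F])
      show "\<exists>u. v = (\<lambda>x. \<Sum>k\<in>UNIV. u k * ?res (per.F k) x)" if v: "v \<in> eigenspace G s X (1 - 2 * g)" for v
      proof -
        obtain u where u: "\<And>x. x \<in> carrier G \<Longrightarrow> v x = (\<Sum>k\<in>UNIV. u k * per.F k x)"
          using per.eigenfun_span_F v space by metis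
        show ?thesis
        proof (intro exI ext)
          show "v x = (\<Sum>k\<in>UNIV. u k * ?res (per.F k) x)" for x
            using v u by (cases "x \<in> carrier G") (simp_all add: space fun_space_def)
        qed
      qed
      show "u k = 0" if 0: "\<And>x. (\<Sum>k\<in>UNIV. u k * ?res (per.F k) x) = 0" for u k
      proof (rule per.F_independent)
        show "(\<Sum>k\<in>UNIV. u k * per.F k x) = 0" if "x \<in> carrier G" for x
          using 0[of x] that by simp
      qed
    qed
    then show ?thesis by simp
  qed
  have "finite {\<mu>. 0 < eig_mult G s X \<mu>}"
  proof -
    \<comment> \<open>One nonzero eigenfunction is picked for each eigenvalue. Orthogonality makes
      the image finite and the choice injective.\<close>
    define \<phi> where "\<phi> \<mu> = (SOME f. f \<in> eigenspace G s X \<mu> \<and> f \<noteq> 0)" for \<mu>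
    let ?E = "{\<mu>. 0 < eig_mult G s X \<mu>}"
    have \<phi>: "\<phi> \<mu> \<in> fun_space G" "act.eigenfun \<mu> (\<phi> \<mu>)" "ip (carrier G) (\<phi> \<mu>) (\<phi> \<mu>) \<noteq> 0" if "\<mu> \<in> ?E" for \<mu>
    proof -
      have "\<phi> \<mu> \<in> eigenspace G s X \<mu> \<and> \<phi> \<mu> \<noteq> 0"
        using someI_ex[OF mult] that by (simp add: \<phi>_def)
      then show "\<phi> \<mu> \<in> fun_space G" "act.eigenfun \<mu> (\<phi> \<mu>)" "ip (carrier G) (\<phi> \<mu>) (\<phi> \<mu>) \<noteq> 0"
        using nz[of "\<phi> \<mu>"] ip_self_eq_0[OF finite_carrier, of "\<phi> \<mu>"] by (auto simp: space)
    qed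
    have "finite (\<phi> ` ?E)"
    proof (rule finite_orthogonal[OF finite_carrier])
      show "f x = 0" if "f \<in> \<phi> ` ?E" "x \<notin> carrier G" for f x
        using that \<phi>(1) by (auto simp: fun_space_def)
      show "ip (carrier G) f g = 0" if "f \<in> \<phi> ` ?E" "g \<in> \<phi> ` ?E" "f \<noteq> g" for f g
        using that \<phi>(2) act.eigenfun_orthogonal by blast
    qed (use \<phi>(3) in blast)
    moreover have "inj_on \<phi> ?E"
    proof (rule inj_onI, rule ccontr)
      fix \<mu> \<nu> assume E: "\<mu> \<in> ?E" "\<nu> \<in> ?E" and eq: "\<phi> \<mu> = \<phi> \<nu>" and "\<mu> \<noteq> \<nu>"
      then have "ip (carrier G) (\<phi> \<mu>) (\<phi> \<nu>) = 0"
        using act.eigenfun_orthogonal[OF \<phi>(2)[OF E(1)] \<phi>(2)[OF E(2)]] by simp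
      then show False using \<phi>(3)[OF E(1)] eq by simp
    qed
    ultimately show ?thesis by (rule finite_imageD)
  qed
  then have "lambda G s X 1 = 1 - 2 * g"
  proof (rule lambda_1_eqI[OF _ mult_1])
    show "\<mu> = 1 \<or> \<mu> \<le> 1 - 2 * g" if "0 < eig_mult G s X \<mu>" for \<mu>
      using mult[OF that] nz per.eigenfun_le space by metis
  qed (use mult_3 g in simp_all)
  then show ?thesis using mult_3 by simp
qed

theorem proposition1p10:
  fixes \<Gamma> :: "'a monoid"
    and s :: "3 \<Rightarrow> 'a"
    and m :: "3 \<Rightarrow> 3 \<Rightarrow> nat"
  assumes "m = coxeter_A3 \<or> m = coxeter_B3 \<or> m = coxeter_H3"
    and "coxeter_system \<Gamma> s m"
  shows "\<forall>X\<in>int_Delta. eig_mult \<Gamma> s X (lambda \<Gamma> s X 1) = 3"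
proof -
  obtain q :: nat where "q \<in> {3, 4, 5}" and "m = path_matrix 3 q"
    using assms(1) unfolding coxeter_A3_def coxeter_B3_def coxeter_H3_def by blast
  then interpret coxeter_group \<Gamma> s q
    using assms(2) by unfold_locales auto
  show ?thesis using eig_mult_lambda_1 by blast
qed

end
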